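(* Let $\mathbb G$ be a positively graded group, let $(\mathbb W,\mathbb V)$ be a pair of complementary subgroups of $\mathbb G$, let $A\subset\mathbb W$ be open, let $\phi:A\to\mathbb V$ be of class $C^2$, and let $\Sigma=\operatorname{graph}(\phi)\subset\mathbb G$ be its $(\mathbb W,\mathbb V)$-graph (oriented). Let $k=\dim\mathbb W$. If $\phi$ is intrinsically differentiable with continuous intrinsic differential, then $$\int_\Sigma\alpha=0\qquad\text{for every }\alpha\in\Omega^{p,k-p}(\mathbb G)\text{ with }p>\deg(\mathbb W).$$
   Context: Positively graded group: a connected, simply connected Lie group $\mathbb{G}$ whose Lie algebra has a decomposition $\mathfrak g=\bigoplus_{i=1}^s\mathfrak g_{w_i}$ with integers $0<w_1<\dots<w_s$ and $[\mathfrak g_{w_i},\mathfrak g_{w_j}]\subseteq\mathfrak g_{w_i+w_j}$ (with $\mathfrak g_w=0$ if $w$ is not one of the $w_i$). Dilations $\delta_\lambda$, $\lambda>0$: the automorphisms acting as $\lambda^{w_i}$ on $\mathfrak g_{w_i}$, transferred to $\mathbb G$ by $\exp$ (a global diffeomorphism). Weights: a left-invariant 1-form that vanishes on all layers except $\mathfrak g_{w_i}$ has weight $w_i$; weights add under wedge products. $\Omega^{p,k-p}(\mathbb G)$ is the space of smooth $k$-forms of weight $p$, i.e. the $C^\infty(\mathbb G)$-span of left-invariant $k$-forms of weight $p$. Degree of a submanifold: let $(X_1,\dots,X_n)$ be a basis of $\mathfrak g$ adapted to the grading; $X_{j_1}\wedge\dots\wedge X_{j_k}$ has degree the sum of the weights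 of the layers containing the $X_{j_i}$. For a $C^1$ $k$-dimensional submanifold $\Sigma$ and $x\in\Sigma$, write a nonzero tangent $k$-vector at $x$ in the basis of left-invariant $k$-vectors $X_J$; $\deg_\Sigma(x)$ is the maximal degree of an $X_J$ with nonzero coefficient, and $\deg(\Sigma)=\max_{x\in\Sigma}\deg_\Sigma(x)$. For a homogeneous subgroup $\mathbb W$ with Lie algebra $\mathfrak w$, $\deg(\mathbb W)=\sum_iw_i\dim(\mathfrak w\cap\mathfrak g_{w_i})$. Intrinsic graphs. Homogeneous subgroups are (Lie) subgroups invariant under all $\delta_\lambda$. $(\mathbb W,\mathbb V)$ is a pair of complementary subgroups if both are homogeneous subgroups, $\mathbb W\cap\mathbb V=\{e\}$ and $\mathbb G=\mathbb W\mathbb V$. The $(\mathbb W,\mathbb V)$-graph of $\phi:A\to\mathbb V$ is $\{w\phi(w):w\in A\}$. A map $L:\mathbb W\to\mathbb V$ is intrinsic linear if its graph $\{wL(w):w\in\mathbb W\}$ is a homogeneous subgroup. For $w\in A$ and $x=w\phi(w)$, the set $x^{-1}\operatorname{graph}(\phi)$ is the intrinsic graph of a map $\phi_{x^{-1}}$ defined near $e\in\mathbb W$ with $\phi_{x^{-1}}(e)=e$; $\phi$ is intrinsically differentiable at $w$ if there is an intrinsic linear $L=d\phi_w$ (the intrinsic differential) with $\|L(u)^{-1}\phi_{x^{-1}}(u)\|=o(\|u\|)$ as $u\to e$ in $\mathbb W$, where $\|\cdot\|$ is the distance to $e$ for a homogeneous distance (left-invariant, 1-homogeneous under $\delta_\lambda$).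 The intrinsic differential is continuous if $w\mapsto d\phi_w$ is continuous for uniform convergence on compact sets. *)

theory Defs
  imports
    "HOL-Analysis.Analysis"
    "HOL-Algebra.Coset"
    "HOL-Library.Landau_Symbols"
begin

section \<open>Maps of class $C^m$ along a linear subspace\<close>

text \<open>
  \<open>Ck_along m T S f\<close>: the map \<open>f\<close> is of class $C^m$ on \<open>S\<close>, where \<open>S\<close> is thought of as a
  relatively open subset of the linear subspace \<open>T\<close>. All partial derivatives are taken in
  directions of \<open>T\<close>; they have to exist and to be continuous up to order \<open>m\<close>. For
  \<open>T = UNIV\<close> and open \<open>S\<close> this is the usual notion.
\<close>

primrec Ck_along ::
    "nat \<Rightarrow> 'a::real_normed_vector set \<Rightarrow> 'a set \<Rightarrow> ('a \<Rightarrow> 'b::real_normed_vector) \<Rightarrow> bool"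
where
  "Ck_along 0 T S f \<longleftrightarrow> continuous_on S f"
| "Ck_along (Suc m) T S f \<longleftrightarrow>
     continuous_on S f \<and>
     (\<forall>v\<in>T. \<exists>f'. (\<forall>x\<in>S. ((\<lambda>t. f (x + t *\<^sub>R v)) has_vector_derivative f' x) (at 0)) \<and>
                 Ck_along m T S f')"

definition smooth :: "('a::real_normed_vector \<Rightarrow> 'b::real_normed_vector) \<Rightarrow> bool" where
  "smooth f \<longleftrightarrow> (\<forall>m. Ck_along m UNIV UNIV f)"


section \<open>Positively graded groups\<close>

text \<open>
  A positively graded group is simply connected and nilpotent, so its exponential map is a
  global diffeomorphism from the Lie algebra onto the group. The manifold structure of the group
  is therefore recorded by its exponential map: topology and smoothness on the group are those
  transported by the global chart \<open>logmap G\<close>. The group itself is an arbitrary abstract group;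
  the Lie algebra (the tangent space at the identity) is the type \<^typ>\<open>'a\<close>. The Lie bracket
  is not a separate datum, it is computed from the group law.
\<close>

record ('g, 'a) graded_lie_group = "'g monoid" +
  expmap :: "'a \<Rightarrow> 'g"
  weights :: "nat set"
  layer :: "nat \<Rightarrow> 'a set"

definition logmap :: "('g, 'a, 'm) graded_lie_group_scheme \<Rightarrow> 'g \<Rightarrow> 'a" where
  "logmap G = inv_into UNIV (expmap G)"

text \<open>The left-invariant vector field with value \<open>X\<close> at the identity, in the chart \<open>logmap G\<close>.\<close>

definition left_field ::
    "('g, 'a::real_normed_vector, 'm) graded_lie_group_scheme \<Rightarrow> 'a \<Rightarrow> 'a \<Rightarrow> 'a" where
  "left_field G X x =
     vector_derivative (\<lambda>t. logmap G (expmap G x \<otimes>\<^bsub>G\<^esub> expmap G (t *\<^sub>R X))) (at 0)"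

text \<open>
  The commutator of the left-invariant vector fields of \<open>X\<close> and \<open>Y\<close>, evaluated at the identity
  by the coordinate formula $[X,Y] = DY\cdot X - DX\cdot Y$.
\<close>

definition lie_bracket ::
    "('g, 'a::real_normed_vector, 'm) graded_lie_group_scheme \<Rightarrow> 'a \<Rightarrow> 'a \<Rightarrow> 'a" where
  "lie_bracket G X Y =
     vector_derivative (\<lambda>t. left_field G Y (t *\<^sub>R X)) (at 0) -
     vector_derivative (\<lambda>t. left_field G X (t *\<^sub>R Y)) (at 0)"

text \<open>
  The first three assumptions say that \<open>G\<close> is a Lie group with exponential map \<open>expmap G\<close>, which
  is a global diffeomorphism. (Inversion is $X \mapsto -X$ in the chart, hence smooth.)
\<close>

locale positively_graded_group = group G
  for G :: "('g, 'a::euclidean_space, 'm) graded_lie_group_scheme" (structure) +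
  assumes exp_bij: "bij_betw (expmap G) UNIV (carrier G)"
    and exp_add: "expmap G ((s + t) *\<^sub>R X) = expmap G (s *\<^sub>R X) \<otimes> expmap G (t *\<^sub>R X)"
    and mult_smooth: "smooth (\<lambda>(X, Y). logmap G (expmap G X \<otimes> expmap G Y))"
    and finite_weights: "finite (weights G)"
    and weights_pos: "w \<in> weights G \<Longrightarrow> 0 < w"
    and layer_subspace: "subspace (layer G w)"
    and layer_trivial: "w \<notin> weights G \<Longrightarrow> layer G w = {0}"
    and layer_direct_sum: "\<exists>!c. (\<forall>w. c w \<in> layer G w) \<and> X = (\<Sum>w\<in>weights G. c w)"
    and layer_bracket:
      "\<lbrakk>X \<in> layer G v; Y \<in> layer G w\<rbrakk> \<Longrightarrow> lie_bracket G X Y \<in> layer G (v + w)"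

definition layer_component ::
    "('g, 'a::real_normed_vector, 'm) graded_lie_group_scheme \<Rightarrow> 'a \<Rightarrow> nat \<Rightarrow> 'a" where
  "layer_component G X =
     (THE c. (\<forall>w. c w \<in> layer G w) \<and> X = (\<Sum>w\<in>weights G. c w))"

definition algebra_dilation ::
    "('g, 'a::real_normed_vector, 'm) graded_lie_group_scheme \<Rightarrow> real \<Rightarrow> 'a \<Rightarrow> 'a" where
  "algebra_dilation G r X = (\<Sum>w\<in>weights G. r ^ w *\<^sub>R layer_component G X w)"

definition dilation ::
    "('g, 'a::real_normed_vector, 'm) graded_lie_group_scheme \<Rightarrow> real \<Rightarrow> 'g \<Rightarrow> 'g" where
  "dilation G r x = expmap G (algebra_dilation G r (logmap G x))"

text \<open>
  Left-invariance and homogeneity force such a distance to induce the topology of the group, so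
  no compatibility is assumed.
\<close>

definition homogeneous_distance ::
    "('g, 'a::real_normed_vector, 'm) graded_lie_group_scheme \<Rightarrow> ('g \<Rightarrow> 'g \<Rightarrow> real) \<Rightarrow> bool" where
  "homogeneous_distance G d \<longleftrightarrow>
     Metric_space (carrier G) d \<and>
     (\<forall>x\<in>carrier G. \<forall>y\<in>carrier G. \<forall>z\<in>carrier G. d (z \<otimes>\<^bsub>G\<^esub> x) (z \<otimes>\<^bsub>G\<^esub> y) = d x y) \<and>
     (\<forall>r>0. \<forall>x\<in>carrier G. \<forall>y\<in>carrier G. d (dilation G r x) (dilation G r y) = r * d x y)"


section \<open>Homogeneous and complementary subgroups\<close>

text \<open>
  A Lie subgroup is a topologically closed subgroup. (A dilation-invariant immersed Lie subgroup
  is connected and hence closed, so nothing is lost.)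
\<close>

definition homogeneous_subgroup ::
    "('g, 'a::real_normed_vector, 'm) graded_lie_group_scheme \<Rightarrow> 'g set \<Rightarrow> bool" where
  "homogeneous_subgroup G H \<longleftrightarrow>
     subgroup H G \<and> closed (logmap G ` H) \<and> (\<forall>r>0. dilation G r ` H \<subseteq> H)"

definition lie_algebra ::
    "('g, 'a::real_normed_vector, 'm) graded_lie_group_scheme \<Rightarrow> 'g set \<Rightarrow> 'a set" where
  "lie_algebra G H = {X. \<forall>t. expmap G (t *\<^sub>R X) \<in> H}"

definition subgroup_degree ::
    "('g, 'a::real_normed_vector, 'm) graded_lie_group_scheme \<Rightarrow> 'g set \<Rightarrow> nat" where
  "subgroup_degree G H = (\<Sum>w\<in>weights G. w * dim (lie_algebra G H \<inter> layer G w))"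

definition complementary_subgroups ::
    "('g, 'a::real_normed_vector, 'm) graded_lie_group_scheme \<Rightarrow> 'g set \<Rightarrow> 'g set \<Rightarrow> bool" where
  "complementary_subgroups G W V \<longleftrightarrow>
     homogeneous_subgroup G W \<and> homogeneous_subgroup G V \<and>
     W \<inter> V = {\<one>\<^bsub>G\<^esub>} \<and> carrier G = W <#>\<^bsub>G\<^esub> V"

definition open_in_subgroup ::
    "('g, 'a::real_normed_vector, 'm) graded_lie_group_scheme \<Rightarrow> 'g set \<Rightarrow> 'g set \<Rightarrow> bool" where
  "open_in_subgroup G W A \<longleftrightarrow>
     A \<subseteq> W \<and> openin (top_of_set (logmap G ` W)) (logmap G ` A)"

definition C2_map ::
    "('g, 'a::real_normed_vector, 'm) graded_lie_group_scheme \<Rightarrow> 'g set \<Rightarrow> 'g set \<Rightarrow> ('g \<Rightarrow> 'g) \<Rightarrow> bool"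
where
  "C2_map G W A \<phi> \<longleftrightarrow>
     Ck_along 2 (lie_algebra G W) (logmap G ` A) (\<lambda>X. logmap G (\<phi> (expmap G X)))"


section \<open>Intrinsic graphs and intrinsic differentials\<close>

definition intrinsic_graph ::
    "('g, 'a, 'm) graded_lie_group_scheme \<Rightarrow> 'g set \<Rightarrow> ('g \<Rightarrow> 'g) \<Rightarrow> 'g set" where
  "intrinsic_graph G A \<phi> = (\<lambda>w. w \<otimes>\<^bsub>G\<^esub> \<phi> w) ` A"

definition intrinsic_linear ::
    "('g, 'a::real_normed_vector, 'm) graded_lie_group_scheme \<Rightarrow> 'g set \<Rightarrow> 'g set \<Rightarrow> ('g \<Rightarrow> 'g) \<Rightarrow> bool"
where
  "intrinsic_linear G W V L \<longleftrightarrow> L \<in> W \<rightarrow> V \<and> homogeneous_subgroup G (intrinsic_graph G W L)"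

text \<open>
  If \<open>S\<close> is an intrinsic graph, then \<open>graph_domain G W V S\<close> and \<open>graph_map G V S\<close> recover the
  domain in \<open>W\<close> and the \<open>V\<close>-valued map whose graph it is.
\<close>

definition graph_domain ::
    "('g, 'a, 'm) graded_lie_group_scheme \<Rightarrow> 'g set \<Rightarrow> 'g set \<Rightarrow> 'g set \<Rightarrow> 'g set" where
  "graph_domain G W V S = {u \<in> W. \<exists>v\<in>V. u \<otimes>\<^bsub>G\<^esub> v \<in> S}"

definition graph_map ::
    "('g, 'a, 'm) graded_lie_group_scheme \<Rightarrow> 'g set \<Rightarrow> 'g set \<Rightarrow> 'g \<Rightarrow> 'g" where
  "graph_map G V S u = (THE v. v \<in> V \<and> u \<otimes>\<^bsub>G\<^esub> v \<in> S)"

text \<open>\<open>S\<close> below is the translated graph $x^{-1}\,\mathrm{graph}(\phi)$ with $x = w\,\phi(w)$.\<close>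

definition has_intrinsic_differential ::
    "('g, 'a::real_normed_vector, 'm) graded_lie_group_scheme \<Rightarrow> ('g \<Rightarrow> 'g \<Rightarrow> real) \<Rightarrow>
     'g set \<Rightarrow> 'g set \<Rightarrow> 'g set \<Rightarrow> ('g \<Rightarrow> 'g) \<Rightarrow> 'g \<Rightarrow> ('g \<Rightarrow> 'g) \<Rightarrow> bool"
where
  "has_intrinsic_differential G d W V A \<phi> w L \<longleftrightarrow>
     intrinsic_linear G W V L \<and>
     (let S = inv\<^bsub>G\<^esub> (w \<otimes>\<^bsub>G\<^esub> \<phi> w) <#\<^bsub>G\<^esub> intrinsic_graph G A \<phi>;
          e_in_W = at 0 within logmap G ` W
      in (\<forall>\<^sub>F X in e_in_W. expmap G X \<in> graph_domain G W V S) \<and>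
         (\<lambda>X. d \<one>\<^bsub>G\<^esub> (inv\<^bsub>G\<^esub> (L (expmap G X)) \<otimes>\<^bsub>G\<^esub> graph_map G V S (expmap G X)))
           \<in> o[e_in_W](\<lambda>X. d \<one>\<^bsub>G\<^esub> (expmap G X)))"

definition continuous_intrinsic_differential ::
    "('g, 'a::real_normed_vector, 'm) graded_lie_group_scheme \<Rightarrow> ('g \<Rightarrow> 'g \<Rightarrow> real) \<Rightarrow>
     'g set \<Rightarrow> 'g set \<Rightarrow> ('g \<Rightarrow> 'g \<Rightarrow> 'g) \<Rightarrow> bool"
where
  "continuous_intrinsic_differential G d W A D \<longleftrightarrow>
     (\<forall>w\<in>A. \<forall>K\<subseteq>W. compact (logmap G ` K) \<longrightarrow>
        (\<forall>\<epsilon>>0. \<forall>\<^sub>F X in at (logmap G w) within logmap G ` A.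
            \<forall>u\<in>K. d (D (expmap G X) u) (D w u) < \<epsilon>))"


section \<open>Differential forms and their weights\<close>

text \<open>
  A $k$-form assigns to a point and to \<open>k\<close> tangent vectors \<open>v 0, \<dots>, v (k - 1)\<close> a real number.
  Tangent vectors at \<open>x\<close> are expressed in the chart \<open>logmap G\<close>; \<open>maurer_cartan G x\<close> is the
  differential at \<open>x\<close> of the left translation by $x^{-1}$.
\<close>

definition maurer_cartan ::
    "('g, 'a::real_normed_vector, 'm) graded_lie_group_scheme \<Rightarrow> 'g \<Rightarrow> 'a \<Rightarrow> 'a" where
  "maurer_cartan G x v =
     vector_derivative
       (\<lambda>t. logmap G (inv\<^bsub>G\<^esub> x \<otimes>\<^bsub>G\<^esub> expmap G (logmap G x + t *\<^sub>R v))) (at 0)"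

text \<open>A left-invariant 1-form is a linear functional on the Lie algebra.\<close>

definition covector_weight ::
    "('g, 'a::real_normed_vector, 'm) graded_lie_group_scheme \<Rightarrow> ('a \<Rightarrow> real) \<Rightarrow> nat \<Rightarrow> bool" where
  "covector_weight G \<theta> w \<longleftrightarrow> linear \<theta> \<and> (\<forall>v. v \<noteq> w \<longrightarrow> (\<forall>X\<in>layer G v. \<theta> X = 0))"

text \<open>The wedge product of the covectors \<open>\<theta> 0, \<dots>, \<theta> (k - 1)\<close>.\<close>

definition wedge :: "nat \<Rightarrow> (nat \<Rightarrow> 'a \<Rightarrow> real) \<Rightarrow> (nat \<Rightarrow> 'a) \<Rightarrow> real" where
  "wedge k \<theta> v = (\<Sum>\<sigma> | \<sigma> permutes {..<k}. of_int (sign \<sigma>) * (\<Prod>i<k. \<theta> i (v (\<sigma> i))))"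

text \<open>
  \<open>weighted_forms G k p\<close> is $\Omega^{p,k-p}$, the $C^\infty$-span of the wedge products of \<open>k\<close>
  left-invariant 1-forms with total weight \<open>p\<close>.
\<close>

definition weighted_forms ::
    "('g, 'a::real_normed_vector, 'm) graded_lie_group_scheme \<Rightarrow> nat \<Rightarrow> nat \<Rightarrow>
     ('g \<Rightarrow> (nat \<Rightarrow> 'a) \<Rightarrow> real) set"
where
  "weighted_forms G k p =
     {\<alpha>. \<exists>(n::nat) f \<theta> wt.
        (\<forall>j<n. smooth (\<lambda>X. f j (expmap G X) :: real) \<and>
               (\<forall>i<k. covector_weight G (\<theta> j i) (wt j i)) \<and> (\<Sum>i<k. wt j i) = p) \<and>
        (\<forall>x\<in>carrier G. \<forall>v. \<alpha> x v = (\<Sum>j<n. f j x * wedge k (\<theta> j) (\<lambda>i. maurer_cartan G x (v i))))}"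


section \<open>Integration of forms over oriented intrinsic graphs\<close>

definition ordered_basis :: "nat \<Rightarrow> (nat \<Rightarrow> 'a::real_vector) \<Rightarrow> 'a set \<Rightarrow> bool" where
  "ordered_basis k b T \<longleftrightarrow>
     inj_on b {..<k} \<and> independent (b ` {..<k}) \<and> span (b ` {..<k}) = T"

definition graph_param ::
    "('g, 'a, 'm) graded_lie_group_scheme \<Rightarrow> ('g \<Rightarrow> 'g) \<Rightarrow> 'a \<Rightarrow> 'g" where
  "graph_param G \<phi> X = expmap G X \<otimes>\<^bsub>G\<^esub> \<phi> (expmap G X)"

text \<open>
  An orientation of the graph of \<open>\<phi> : A \<rightarrow> V\<close> is encoded by a continuous sign on \<open>logmap G ` A\<close>,
  comparing it with the orientation induced by an ordered basis of the Lie algebra of \<open>W\<close>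
  through \<open>graph_param G \<phi>\<close>. (The sign can differ between connected components of \<open>A\<close>.)
\<close>

definition orientation_sign ::
    "('g, 'a::real_normed_vector, 'm) graded_lie_group_scheme \<Rightarrow> 'g set \<Rightarrow> ('a \<Rightarrow> real) \<Rightarrow> bool" where
  "orientation_sign G A \<epsilon> \<longleftrightarrow>
     continuous_on (logmap G ` A) \<epsilon> \<and> \<epsilon> ` (logmap G ` A) \<subseteq> {-1, 1}"

text \<open>
  The integral over the graph of \<open>\<phi> : A \<rightarrow> V\<close> exists (absolutely) and equals \<open>I\<close>. It is the integral of the
  pulled back form in the coordinates \<open>u 0, \<dots>, u (k - 1)\<close> with respect to the basis \<open>b\<close> of the
  Lie algebra of \<open>W\<close>.
\<close>

definition has_graph_integral ::
    "('g, 'a::real_normed_vector, 'm) graded_lie_group_scheme \<Rightarrow> nat \<Rightarrow> (nat \<Rightarrow> 'a) \<Rightarrow>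
     'g set \<Rightarrow> ('g \<Rightarrow> 'g) \<Rightarrow> ('a \<Rightarrow> real) \<Rightarrow> ('g \<Rightarrow> (nat \<Rightarrow> 'a) \<Rightarrow> real) \<Rightarrow> real \<Rightarrow> bool"
where
  "has_graph_integral G k b A \<phi> \<epsilon> \<alpha> I \<longleftrightarrow>
     has_bochner_integral (\<Pi>\<^sub>M i\<in>{..<k}. lborel)
       (\<lambda>u. let X = (\<Sum>i<k. u i *\<^sub>R b i) in
          indicator (logmap G ` A) X * (\<epsilon> X *
            \<alpha> (graph_param G \<phi> X)
              (\<lambda>i. vector_derivative (\<lambda>t. logmap G (graph_param G \<phi> (X + t *\<^sub>R b i))) (at 0))))
       I"

end

(* The pulled back form vanishes at every point x of the graph. Let F: W -> G be the graph map, translated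
   so that x becomes the identity, and let tau be its differential on the Lie algebra of W. For X in the
   layer of weight w of that Lie algebra, intrinsic differentiability bounds the point of the translated
   graph above exp(r^w X) by a multiple of r in the homogeneous norm, so its components of weight v > w
   are O(r^v). Dividing by the Euclidean size of the displacement and letting r tend to 0 yields a tangent
   vector tau Y that equals X modulo the Lie algebra of V and has no components of weight above w. Since
   the two Lie algebras are transversal, a graded basis of Lie(W) produces in this way a basis of the
   tangent space of the graph. In that basis every term of the Leibniz expansion of a wedge product of
   total weight exceeding deg(W) contains a covector evaluated on a vector without components in its layer. *)

theory Submission imports Defs "Jordan_Normal_Form.Determinant" begin

text \<open>The parameter in which intrinsic differentiability is stated is not the one in which the
  graph is differentiable in the ordinary sense. Translating a point of the graph to the identity
  changes its factorisation along \<open>W\<close> and \<open>V\<close>, so a point over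
  \<open>X\<close> after translation corresponds to some displacement \<open>Y\<close> of the
  original parameter. The two are tied only by an equation \<open>X \<star> Z = g Y\<close> with
  \<open>Z\<close> in the Lie algebra of \<open>V\<close>. The size of \<open>Y\<close> compared
  with that of \<open>X\<close> is not known in advance. The blow-up therefore divides by the sum of
  both sizes and extracts a convergent subsequence. Transversality of the tangent space to the Lie
  algebra of \<open>V\<close> then shows that the share of \<open>X\<close> survives in the limit.
  Two compactness facts carry the estimates. A homogeneous distance, given without any relation to
  the topology, is comparable layer by layer with powers of the Euclidean norm. Two homogeneous
  subgroups with trivial intersection are separated linearly in that distance; applied to the graph
  of the intrinsic differential and \<open>V\<close>, this bounds the differential.\<close>

section \<open>Wedge products as determinants\<close>

lemma wedge_eq_det:
  "wedge k \<theta> v = Determinant.det (Matrix.mat k k (\<lambda>(i, j). \<theta> i (v j)))"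
proof -
  have A: "Matrix.mat k k (\<lambda>(i, j). \<theta> i (v j)) \<in> carrier_mat k k" by simp
  have "(\<Prod>i<k. Matrix.mat k k (\<lambda>(i, j). \<theta> i (v j)) $$ (i, \<sigma> i)) = (\<Prod>i<k. \<theta> i (v (\<sigma> i)))"
    if "\<sigma> permutes {..<k}" for \<sigma>
    using permutes_in_image[OF that] by (intro prod.cong) auto
  then show ?thesis
    unfolding wedge_def det_def'[OF A] atLeast0LessThan by (intro sum.cong) simp_all
qed

text \<open>The matrix of values factors, so the determinant is multiplicative. The coefficients
  \<open>c\<close> are arbitrary: to kill the form on \<open>v\<close> it is enough that it vanishes
  on a family \<open>u\<close> whose span contains \<open>v\<close>.\<close>

lemma wedge_change_basis:
  assumes lin: "\<And>i. i < k \<Longrightarrow> linear (\<theta> i)"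
    and v: "\<And>j. j < k \<Longrightarrow> v j = (\<Sum>l<k. c l j *\<^sub>R u l)"
  shows "wedge k \<theta> v = wedge k \<theta> u * Determinant.det (Matrix.mat k k (\<lambda>(l, j). c l j))"
proof -
  let ?U = "Matrix.mat k k (\<lambda>(i, j). \<theta> i (u j))"
  let ?C = "Matrix.mat k k (\<lambda>(l, j). c l j)"
  have "Matrix.mat k k (\<lambda>(i, j). \<theta> i (v j)) = ?U * ?C"
  proof (rule eq_matI)
    fix i j assume "i < dim_row (?U * ?C)" "j < dim_col (?U * ?C)"
    then have ij: "i < k" "j < k" by auto
    have "\<theta> i (v j) = (\<Sum>l<k. c l j * \<theta> i (u l))"
      using lin[OF ij(1)] v[OF ij(2)] by (simp add: linear_sum linear_scale)
    then show "Matrix.mat k k (\<lambda>(i, j). \<theta> i (v j)) $$ (i, j) = (?U * ?C) $$ (i, j)"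
      using ij by (simp add: scalar_prod_def atLeast0LessThan mult.commute)
  qed auto
  then show ?thesis
    unfolding wedge_eq_det by (simp add: Determinant.det_mult[of _ k])
qed

text \<open>Pigeonhole on each permutation: if no index had
  \<open>\<mu> (\<sigma> i) < wt i\<close>, summing the reverse inequalities would contradict
  \<open>less\<close>. Here \<open>\<mu> l\<close> stands for the highest weight in which
  \<open>u l\<close> may have a component.\<close>

lemma wedge_eq_0_if_weights_exceed:
  fixes \<theta> :: "nat \<Rightarrow> 'a::real_normed_vector \<Rightarrow> real" and wt \<mu> :: "nat \<Rightarrow> nat"
  assumes van: "\<And>i l. \<lbrakk>i < k; l < k; \<mu> l < wt i\<rbrakk> \<Longrightarrow> \<theta> i (u l) = 0"
    and less: "(\<Sum>l<k. \<mu> l) < (\<Sum>i<k. wt i)"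
  shows "wedge k \<theta> u = 0"
  unfolding wedge_def
proof (intro sum.neutral ballI)
  fix \<sigma> assume "\<sigma> \<in> {\<sigma>. \<sigma> permutes {..<k}}"
  then have \<sigma>: "\<sigma> permutes {..<k}" by simp
  have "\<exists>i<k. \<mu> (\<sigma> i) < wt i"
  proof (rule ccontr)
    assume "\<not> (\<exists>i<k. \<mu> (\<sigma> i) < wt i)"
    then have le: "wt i \<le> \<mu> (\<sigma> i)" if "i < k" for i using that by (metis not_less)
    have "(\<Sum>i<k. wt i) \<le> (\<Sum>i<k. \<mu> (\<sigma> i))" by (intro sum_mono le) simp
    also have "\<dots> = (\<Sum>l<k. \<mu> l)" using sum.permute[OF \<sigma>, of \<mu>] by (simp add: o_def)
    finally show False using less by simp
  qed
  then obtain i where i: "i < k" "\<mu> (\<sigma> i) < wt i" by blast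
  then have "\<theta> i (u (\<sigma> i)) = 0" using van permutes_in_image[OF \<sigma>, of i] by simp
  then have "(\<Prod>i<k. \<theta> i (u (\<sigma> i))) = 0" using i by (intro prod_zero) auto
  then show "of_int (sign \<sigma>) * (\<Prod>i<k. \<theta> i (u (\<sigma> i))) = 0" by simp
qed

section \<open>Differentiability relative to a subspace\<close>

lemma orthonormal_expansion:
  fixes B :: "'a::euclidean_space set"
  assumes "pairwise Linear_Algebra.orthogonal B" "\<And>e. e \<in> B \<Longrightarrow> norm e = 1" "finite B" "y \<in> span B"
  shows "(\<Sum>e\<in>B. inner y e *\<^sub>R e) = y"
proof -
  let ?z = "y - (\<Sum>e\<in>B. inner y e *\<^sub>R e)"
  have "inner ?z b = 0" if "b \<in> B" for b
  proof -
    have "(\<Sum>e\<in>B. inner y e * inner e b) = (\<Sum>e\<in>B. if e = b then inner y b else 0)"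
      using assms(1,2) that
      by (intro sum.cong) (auto simp: pairwise_def Linear_Algebra.orthogonal_def dot_square_norm)
    then show ?thesis using that assms(3) by (simp add: inner_diff_left inner_sum_left)
  qed
  then have orth: "Linear_Algebra.orthogonal ?z b" if "b \<in> span B" for b
    using orthogonal_to_span[OF that] by (simp add: Linear_Algebra.orthogonal_def)
  have "?z \<in> span B" by (intro span_diff assms(4) span_sum span_mul span_base)
  with orth have "Linear_Algebra.orthogonal ?z ?z" by blast
  then show ?thesis by (simp add: orthogonal_self)
qed

text \<open>The classical argument of changing one coordinate at a time, with the mean value
  inequality on each segment. An orthonormal basis of \<open>T\<close> takes the place of the
  standard basis, because \<open>S\<close> is open only relative to \<open>T\<close>.\<close>

lemma has_derivative_within_if_partials_continuous:
  fixes f :: "'a::euclidean_space \<Rightarrow> 'b::real_normed_vector"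
  assumes T: "subspace T" and S: "openin (top_of_set T) S" and x: "x \<in> S"
    and part: "\<And>v. v \<in> T \<Longrightarrow> \<exists>f'. (\<forall>y\<in>S. ((\<lambda>t. f (y + t *\<^sub>R v)) has_vector_derivative f' y) (at 0)) \<and>
      continuous_on S f'"
  shows "\<exists>D. (f has_derivative D) (at x within S)"
proof -
  obtain B where B: "B \<subseteq> T" "pairwise Linear_Algebra.orthogonal B" "\<And>e. e \<in> B \<Longrightarrow> norm e = 1"
    "independent B" "span B = T"
    using orthonormal_basis_subspace[OF T] by metis
  have finB: "finite B" using B(4) independent_imp_finite by blast
  have "\<forall>e\<in>B. \<exists>f'. (\<forall>y\<in>S. ((\<lambda>t. f (y + t *\<^sub>R e)) has_vector_derivative f' y) (at 0)) \<and> continuous_on S f'"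
    using part B(1) by blast
  then obtain g where g: "\<And>e y. \<lbrakk>e \<in> B; y \<in> S\<rbrakk> \<Longrightarrow>
      ((\<lambda>t. f (y + t *\<^sub>R e)) has_vector_derivative g e y) (at 0)"
    and gc: "\<And>e. e \<in> B \<Longrightarrow> continuous_on S (g e)" by metis
  have xT: "x \<in> T" using S x openin_imp_subset by blast
  obtain \<rho> where \<rho>: "\<rho> > 0" "ball x \<rho> \<inter> T \<subseteq> S"
    using S x by (meson openin_contains_ball)
  \<comment> \<open>\<open>P C\<close> is the orthogonal projection onto the span of
    \<open>C\<close>; the induction on \<open>C\<close> releases the coordinates
    successively.\<close>
  define P where "P C y = (\<Sum>e\<in>C. inner y e *\<^sub>R e)" for C :: "'a set" and y
  have claim: "\<forall>\<epsilon>>0. \<exists>\<delta>>0. \<forall>y. norm y < \<delta> \<longrightarrow>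
      norm (f (x + P C y) - f x - (\<Sum>e\<in>C. inner y e *\<^sub>R g e x)) \<le> \<epsilon> * norm y"
    if "C \<subseteq> B" for C
    using finite_subset[OF that finB] that
  proof (induction C rule: finite_induct)
    case empty
    show ?case by (auto simp: P_def intro!: exI[of _ 1])
  next
    case (insert e C)
    show ?case
    proof (intro allI impI)
      fix \<epsilon> :: real assume "\<epsilon> > 0"
      then have e2: "\<epsilon> / 2 > 0" by simp
      from insert.IH insert.prems e2 obtain \<delta>1 where \<delta>1: "\<delta>1 > 0"
        "\<And>y. norm y < \<delta>1 \<Longrightarrow> norm (f (x + P C y) - f x - (\<Sum>e\<in>C. inner y e *\<^sub>R g e x)) \<le> \<epsilon> / 2 * norm y"
        by (metis insert_subset)
      have eB: "e \<in> B" using insert.prems by simp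
      obtain \<delta>2 where \<delta>2: "\<delta>2 > 0" "\<And>z. \<lbrakk>z \<in> S; dist z x < \<delta>2\<rbrakk> \<Longrightarrow> dist (g e z) (g e x) < \<epsilon> / 2"
        using gc[OF eB] x e2 unfolding continuous_on_iff by blast
      \<comment> \<open>Each coordinate already released moves the point by at most
        \<open>norm y\<close>, and the new one adds one more such step. Hence the segment stays
        within \<open>K * norm y\<close> of \<open>x\<close>.\<close>
      define K where "K = real (card C) + 1"
      have K: "K > 0" by (simp add: K_def)
      define \<delta> where "\<delta> = min \<delta>1 (min \<rho> \<delta>2 / K)"
      have "\<delta> > 0" using \<delta>1 \<delta>2 \<rho> K by (simp add: \<delta>_def)
      moreover have "norm (f (x + P (insert e C) y) - f x - (\<Sum>e\<in>insert e C. inner y e *\<^sub>R g e x)) \<le> \<epsilon> * norm y"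
        if y: "norm y < \<delta>" for y
      proof -
        have ne: "\<bar>inner y e'\<bar> \<le> norm y" if "e' \<in> B" for e'
          using Cauchy_Schwarz_ineq2[of y e'] B(3)[OF that] by simp
        have "norm (P C y) \<le> (\<Sum>e\<in>C. norm y)"
          unfolding P_def
        proof (intro sum_norm_le)
          fix c assume "c \<in> C"
          then have "c \<in> B" using insert.prems by blast
          then show "norm (inner y c *\<^sub>R c) \<le> norm y" using ne B(3) by simp
        qed
        then have nP: "norm (P C y) \<le> real (card C) * norm y" by simp
        define z where "z t = x + P C y + t *\<^sub>R e" for t
        have PT: "P C y \<in> T"
          unfolding P_def using insert.prems B(1) by (intro subspace_sum[OF T] subspace_scale[OF T]) auto
        have zS: "z t \<in> S \<and> dist (z t) x < \<delta>2" if t: "\<bar>t\<bar> \<le> norm y" for t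
        proof -
          have "norm (z t - x) \<le> norm (P C y) + norm (t *\<^sub>R e)"
            unfolding z_def by (metis add_diff_cancel_left' add.assoc norm_triangle_ineq)
          also have "\<dots> \<le> K * norm y" using nP t B(3)[OF eB] by (simp add: K_def algebra_simps)
          also have "\<dots> < min \<rho> \<delta>2" using y K by (auto simp: \<delta>_def field_simps)
          finally have "dist (z t) x < min \<rho> \<delta>2" by (simp add: dist_norm)
          moreover have "z t \<in> T" unfolding z_def
            using xT PT eB B(1) T by (intro subspace_add subspace_scale) auto
          ultimately show ?thesis using \<rho>(2) by (auto simp: dist_commute)
        qed
        define s where "s = inner y e"
        have seg: "\<bar>t\<bar> \<le> norm y" if "t \<in> closed_segment 0 s" for t
          using that ne[OF eB] by (auto simp: s_def closed_segment_eq_real_ivl split: if_splits)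
        \<comment> \<open>Subtracting the expected linear part leaves the derivative
          \<open>g e (z t) - g e x\<close>, which continuity makes smaller than half of
          \<epsilon>.\<close>
        define H where "H t = f (z t) - t *\<^sub>R g e x" for t
        have dH: "(H has_derivative (\<lambda>h. h *\<^sub>R (g e (z t) - g e x))) (at t within closed_segment 0 s)"
          if "t \<in> closed_segment 0 s" for t
        proof -
          \<comment> \<open>Partial derivatives are given at parameter 0 only. Basing the line at
            \<open>z t\<close> and shifting the parameter by \<open>t\<close> gives the derivative
            at \<open>t\<close>.\<close>
          have 0: "((\<lambda>r. f (z t + r *\<^sub>R e)) has_vector_derivative g e (z t)) (at 0)"
            using g[OF eB] zS[OF seg[OF that]] by blast
          have sh: "((\<lambda>r. r - t) has_vector_derivative 1) (at t)"
            by (auto simp: has_vector_derivative_def intro!: derivative_eq_intros)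
          have "((\<lambda>r. f (z t + (r - t) *\<^sub>R e)) has_vector_derivative g e (z t)) (at t)"
            using vector_diff_chain_at[of "\<lambda>r. r - t" 1 t "\<lambda>r. f (z t + r *\<^sub>R e)" "g e (z t)"] 0
            by (simp add: o_def sh)
          moreover have "(\<lambda>r. f (z t + (r - t) *\<^sub>R e)) = (\<lambda>r. f (z r))"
            by (auto simp: z_def algebra_simps)
          ultimately have "((\<lambda>r. f (z r)) has_vector_derivative g e (z t)) (at t)" by simp
          then have "(H has_vector_derivative (g e (z t) - g e x)) (at t)"
            unfolding H_def by (auto intro!: derivative_eq_intros)
          then show ?thesis
            by (simp add: has_vector_derivative_def has_derivative_at_withinI)
        qed
        have "norm (H s - H 0) \<le> \<epsilon> / 2 * norm (s - 0)"
        proof (rule differentiable_bound[OF convex_closed_segment dH])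
          fix t assume t: "t \<in> closed_segment 0 s"
          have "onorm (\<lambda>h. h *\<^sub>R (g e (z t) - g e x)) \<le> norm (g e (z t) - g e x)"
            by (intro onorm_bound) (auto simp: mult.commute)
          also have "\<dots> \<le> \<epsilon> / 2" using \<delta>2(2) zS[OF seg[OF t]] by (simp add: dist_norm less_imp_le)
          finally show "onorm (\<lambda>h. h *\<^sub>R (g e (z t) - g e x)) \<le> \<epsilon> / 2" .
        qed auto
        also have "\<dots> \<le> \<epsilon> / 2 * norm y" using ne[OF eB] e2 by (simp add: s_def mult_left_mono)
        finally have 1: "norm (H s - H 0) \<le> \<epsilon> / 2 * norm y" .
        have 2: "norm (f (x + P C y) - f x - (\<Sum>e\<in>C. inner y e *\<^sub>R g e x)) \<le> \<epsilon> / 2 * norm y"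
          using \<delta>1(2) y by (simp add: \<delta>_def)
        have "f (x + P (insert e C) y) - f x - (\<Sum>e\<in>insert e C. inner y e *\<^sub>R g e x) =
          (H s - H 0) + (f (x + P C y) - f x - (\<Sum>e\<in>C. inner y e *\<^sub>R g e x))"
          using insert.hyps by (simp add: P_def H_def z_def s_def algebra_simps)
        moreover have "norm ((H s - H 0) + (f (x + P C y) - f x - (\<Sum>e\<in>C. inner y e *\<^sub>R g e x)))
            \<le> \<epsilon> * norm y"
          using norm_triangle_le[OF add_mono[OF 1 2]] by simp
        ultimately show ?thesis by (simp only:)
      qed
      ultimately show "\<exists>\<delta>>0. \<forall>y. norm y < \<delta> \<longrightarrow>
        norm (f (x + P (insert e C) y) - f x - (\<Sum>e\<in>insert e C. inner y e *\<^sub>R g e x)) \<le> \<epsilon> * norm y"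
        by blast
    qed
  qed
  have PB: "P B y = y" if "y \<in> T" for y
    unfolding P_def using orthonormal_expansion[OF B(2,3) finB] that B(5) by simp
  have "(f has_derivative (\<lambda>y. \<Sum>e\<in>B. inner y e *\<^sub>R g e x)) (at x within S)"
    unfolding has_derivative_within_alt
  proof (intro conjI allI impI)
    show "bounded_linear (\<lambda>y. \<Sum>e\<in>B. inner y e *\<^sub>R g e x)"
      by (intro bounded_linear_sum bounded_linear_scaleR_const bounded_linear_inner_left)
    fix \<epsilon> :: real assume "\<epsilon> > 0"
    then obtain \<delta> where \<delta>: "\<delta> > 0" "\<And>y. norm y < \<delta> \<Longrightarrow>
        norm (f (x + P B y) - f x - (\<Sum>e\<in>B. inner y e *\<^sub>R g e x)) \<le> \<epsilon> * norm y"
      using claim[OF order_refl] by meson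
    have "norm (f y - f x - (\<Sum>e\<in>B. inner (y - x) e *\<^sub>R g e x)) \<le> \<epsilon> * norm (y - x)"
      if "y \<in> S" "norm (y - x) < \<delta>" for y
    proof -
      have "y - x \<in> T" using that(1) S xT T openin_imp_subset subspace_diff by blast
      then show ?thesis using \<delta>(2)[OF that(2)] PB by simp
    qed
    then show "\<exists>d>0. \<forall>y\<in>S. norm (y - x) < d \<longrightarrow>
        norm (f y - f x - (\<Sum>e\<in>B. inner (y - x) e *\<^sub>R g e x)) \<le> \<epsilon> * norm (y - x)"
      using \<delta>(1) by blast
  qed
  then show ?thesis by blast
qed

lemma Ck_along_Suc_imp_has_derivative:
  fixes f :: "'a::euclidean_space \<Rightarrow> 'b::real_normed_vector"
  assumes "Ck_along (Suc m) T S f" "subspace T" "openin (top_of_set T) S" "x \<in> S"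
  shows "\<exists>D. (f has_derivative D) (at x within S)"
proof (rule has_derivative_within_if_partials_continuous[OF assms(2-4)])
  fix v assume "v \<in> T"
  moreover have "continuous_on S f'" if "Ck_along m T S f'" for f' :: "'a \<Rightarrow> 'b"
    using that by (cases m) auto
  ultimately show "\<exists>f'. (\<forall>y\<in>S. ((\<lambda>t. f (y + t *\<^sub>R v)) has_vector_derivative f' y) (at 0)) \<and>
      continuous_on S f'"
    using assms(1) by (auto 4 4)
qed

text \<open>Boundedness of \<open>h n /\<^sub>R s n\<close> turns a remainder that is small against
  \<open>h n\<close> into one that is small against \<open>s n\<close>. The points
  \<open>x + h n\<close> need not lie on a ray and the scale \<open>s n\<close> need not be
  \<open>norm (h n)\<close>; both freedoms are used in the blow-up.\<close>

lemma has_derivative_sequential_quotient: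
  fixes f :: "'a::real_normed_vector \<Rightarrow> 'b::real_normed_vector"
  assumes f: "(f has_derivative D) (at x within S)"
    and S: "\<And>n. x + h n \<in> S" and h: "h \<longlonglongrightarrow> 0"
    and lim: "(\<lambda>n. h n /\<^sub>R s n) \<longlonglongrightarrow> Y"
  shows "(\<lambda>n. (f (x + h n) - f x) /\<^sub>R s n) \<longlonglongrightarrow> D Y"
proof -
  have bl: "bounded_linear D" using f has_derivative_bounded_linear by blast
  define R where "R n = f (x + h n) - f x - D (h n)" for n
  obtain M where M: "M > 0" "\<And>n. norm (h n /\<^sub>R s n) \<le> M"
    using BseqE[OF convergent_imp_Bseq[OF convergentI[OF lim]]] by blast
  have "(\<lambda>n. R n /\<^sub>R s n) \<longlonglongrightarrow> 0"
    unfolding lim_sequentially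
  proof (intro allI impI)
    fix r :: real assume r: "r > 0"
    define e where "e = r / (2 * M)"
    have e: "e > 0" using r M(1) by (simp add: e_def)
    then obtain \<delta> where \<delta>: "\<delta> > 0"
        "\<And>y. \<lbrakk>y \<in> S; norm (y - x) < \<delta>\<rbrakk> \<Longrightarrow> norm (f y - f x - D (y - x)) \<le> e * norm (y - x)"
      using f unfolding has_derivative_within_alt by blast
    obtain N where N: "\<And>n. n \<ge> N \<Longrightarrow> norm (h n) < \<delta>"
      using h \<delta>(1) unfolding lim_sequentially by (auto simp: dist_norm)
    have "dist (R n /\<^sub>R s n) 0 < r" if "n \<ge> N" for n
    proof -
      have "norm (R n) \<le> e * norm (h n)"
        using \<delta>(2)[OF S[of n]] N[OF that] by (simp add: R_def)
      then have "\<bar>inverse (s n)\<bar> * norm (R n) \<le> \<bar>inverse (s n)\<bar> * (e * norm (h n))"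
        by (intro mult_left_mono) auto
      also have "\<dots> = e * norm (h n /\<^sub>R s n)" by simp
      also have "\<dots> \<le> e * M" using M(2)[of n] e by (intro mult_left_mono) auto
      also have "\<dots> < r" using M(1) r by (simp add: e_def)
      finally show ?thesis by simp
    qed
    then show "\<exists>N. \<forall>n\<ge>N. dist (R n /\<^sub>R s n) 0 < r" by blast
  qed
  moreover have "(\<lambda>n. D (h n /\<^sub>R s n)) \<longlonglongrightarrow> D Y"
    by (rule bounded_linear.tendsto[OF bl lim])
  ultimately have "(\<lambda>n. R n /\<^sub>R s n + D (h n /\<^sub>R s n)) \<longlonglongrightarrow> 0 + D Y"
    by (rule tendsto_add)
  moreover have "R n /\<^sub>R s n + D (h n /\<^sub>R s n) = (f (x + h n) - f x) /\<^sub>R s n" for n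
    using linear_scale[OF bounded_linear.linear[OF bl]] by (simp add: R_def scaleR_diff_right)
  ultimately show ?thesis by simp
qed

section \<open>The group law in exponential coordinates\<close>

context positively_graded_group
begin

text \<open>This is the Baker-Campbell-Hausdorff product, handled through its smoothness and the
  group laws instead of its series.\<close>

definition star :: "'a \<Rightarrow> 'a \<Rightarrow> 'a" (infixl "\<star>" 70) where
  "X \<star> Y = logmap G (expmap G X \<otimes> expmap G Y)"

abbreviation dil :: "real \<Rightarrow> 'a \<Rightarrow> 'a" where "dil \<equiv> algebra_dilation G"

abbreviation comp :: "'a \<Rightarrow> nat \<Rightarrow> 'a" where "comp \<equiv> layer_component G"

lemma exp_closed [simp]: "expmap G X \<in> carrier G"
  using exp_bij by (auto simp: bij_betw_def)

lemma log_exp [simp]: "logmap G (expmap G X) = X"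
  using exp_bij unfolding logmap_def bij_betw_def by (simp add: inv_into_f_f)

lemma exp_log [simp]: "x \<in> carrier G \<Longrightarrow> expmap G (logmap G x) = x"
  using exp_bij unfolding logmap_def bij_betw_def by (metis f_inv_into_f)

lemma exp_inj: "expmap G X = expmap G Y \<longleftrightarrow> X = Y"
  by (metis log_exp)

lemma exp_star: "expmap G (X \<star> Y) = expmap G X \<otimes> expmap G Y"
  by (simp add: star_def)

lemma exp_zero: "expmap G 0 = \<one>"
proof -
  have "expmap G 0 \<otimes> expmap G 0 = expmap G 0" using exp_add[of 0 0 0] by simp
  then show ?thesis using exp_closed l_cancel_one by metis
qed

lemma log_one: "logmap G \<one> = 0"
  by (metis exp_zero log_exp)

lemma star_assoc: "X \<star> Y \<star> Z = X \<star> (Y \<star> Z)"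
  unfolding star_def by (simp add: m_assoc)

lemma star_zero [simp]: "X \<star> 0 = X" "0 \<star> X = X"
  by (simp_all add: star_def exp_zero)

lemma star_scaleR: "(s *\<^sub>R X) \<star> (t *\<^sub>R X) = (s + t) *\<^sub>R X"
  by (simp add: star_def exp_add[symmetric])

lemma star_minus [simp]: "X \<star> (- X) = 0" "(- X) \<star> X = 0"
  using star_scaleR[of 1 X "-1"] star_scaleR[of "-1" X 1] by simp_all

lemma star_cancel [simp]: "(- X) \<star> (X \<star> Y) = Y" "X \<star> ((- X) \<star> Y) = Y"
  by (simp_all add: star_assoc[symmetric])

lemma exp_minus: "expmap G (- X) = inv (expmap G X)"
  by (metis inv_equality exp_star exp_zero star_minus(2) exp_closed)

lemma minus_star: "- (X \<star> Y) = (- Y) \<star> (- X)"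
  by (metis exp_closed exp_inj exp_minus exp_star inv_mult_group)

lemma log_mult: "\<lbrakk>x \<in> carrier G; y \<in> carrier G\<rbrakk> \<Longrightarrow> logmap G (x \<otimes> y) = logmap G x \<star> logmap G y"
  by (simp add: star_def)

lemma log_inv: "x \<in> carrier G \<Longrightarrow> logmap G (inv x) = - logmap G x"
  by (metis exp_log exp_minus log_exp)

lemma star_has_derivative_ex: "\<exists>D. ((\<lambda>p. fst p \<star> snd p) has_derivative D) (at p)"
proof -
  have "Ck_along (Suc 0) UNIV UNIV (\<lambda>(X, Y). logmap G (expmap G X \<otimes> expmap G Y))"
    using mult_smooth unfolding smooth_def by blast
  from Ck_along_Suc_imp_has_derivative[OF this, of p] show ?thesis
    by (simp add: star_def case_prod_unfold openin_open subspace_UNIV)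
qed

lemma continuous_on_star [continuous_intros]:
  assumes "continuous_on S f" "continuous_on S g"
  shows "continuous_on S (\<lambda>x. f x \<star> g x)"
proof -
  have "continuous_on UNIV (\<lambda>p. fst p \<star> snd p)"
    using star_has_derivative_ex has_derivative_continuous
    by (metis continuous_at_imp_continuous_on)
  from continuous_on_compose2[OF this continuous_on_Pair[OF assms]] show ?thesis by simp
qed

lemma tendsto_star [tendsto_intros]:
  assumes "(f \<longlongrightarrow> a) F" "(g \<longlongrightarrow> b) F"
  shows "((\<lambda>x. f x \<star> g x) \<longlongrightarrow> a \<star> b) F"
proof -
  have "isCont (\<lambda>p. fst p \<star> snd p) (a, b)"
    using star_has_derivative_ex has_derivative_continuous by blast
  from isCont_tendsto_compose[OF this tendsto_Pair[OF assms]] show ?thesis by simp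
qed

text \<open>On each axis the product with \<open>0\<close> is the identity, which determines the derivative.\<close>

lemma star_has_derivative_zero:
  "((\<lambda>p. fst p \<star> snd p) has_derivative (\<lambda>p. fst p + snd p)) (at (0, 0))"
proof -
  obtain D where D: "((\<lambda>p. fst p \<star> snd p) has_derivative D) (at (0 :: 'a, 0))"
    using star_has_derivative_ex by blast
  have "((\<lambda>X. (X, 0::'a)) has_derivative (\<lambda>h. (h, 0))) (at (0::'a))"
    by (intro derivative_intros)
  from has_derivative_compose[OF this D]
  have "((\<lambda>X. X) has_derivative (\<lambda>h. D (h, 0))) (at (0::'a))" by simp
  then have D1: "D (h, 0) = h" for h
    using has_derivative_unique[OF has_derivative_ident] by metis
  have "((\<lambda>X. (0::'a, X)) has_derivative (\<lambda>h. (0, h))) (at (0::'a))"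
    by (intro derivative_intros)
  from has_derivative_compose[OF this D]
  have "((\<lambda>X. X) has_derivative (\<lambda>h. D (0, h))) (at (0::'a))" by simp
  then have D2: "D (0, h) = h" for h
    using has_derivative_unique[OF has_derivative_ident] by metis
  have "linear D" using D has_derivative_linear by blast
  then have "D p = fst p + snd p" for p
    using linear_add[of D "(fst p, 0)" "(0, snd p)"] D1 D2 by simp
  then have "D = (\<lambda>p. fst p + snd p)" by auto
  then show ?thesis using D by simp
qed

lemma star_has_derivative_at_zero:
  assumes f: "(f has_derivative f') (at x within S)" and g: "(g has_derivative g') (at x within S)"
    and "f x = 0" "g x = 0"
  shows "((\<lambda>y. f y \<star> g y) has_derivative (\<lambda>h. f' h + g' h)) (at x within S)"
proof -
  have "((\<lambda>p. fst p \<star> snd p) has_derivative (\<lambda>p. fst p + snd p))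
      (at (f x, g x) within (\<lambda>y. (f y, g y)) ` S)"
    using has_derivative_at_withinI[OF star_has_derivative_zero] assms(3,4) by simp
  from has_derivative_in_compose[OF has_derivative_Pair[OF f g] this] show ?thesis by simp
qed

lemma star_has_derivative_compose:
  assumes f: "(f has_derivative f') (at x within S)" and g: "(g has_derivative g') (at x within S)"
  shows "\<exists>D. ((\<lambda>y. f y \<star> g y) has_derivative D) (at x within S)"
proof -
  obtain D where "((\<lambda>p. fst p \<star> snd p) has_derivative D) (at (f x, g x) within (\<lambda>y. (f y, g y)) ` S)"
    using star_has_derivative_ex has_derivative_at_withinI by blast
  from has_derivative_in_compose[OF has_derivative_Pair[OF f g] this] show ?thesis by auto
qed

section \<open>Layer components and dilations\<close>

lemma comp_props: "(\<forall>w. comp X w \<in> layer G w) \<and> X = (\<Sum>w\<in>weights G. comp X w)"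
  unfolding layer_component_def by (rule theI'[OF layer_direct_sum])

lemma comp_in_layer [simp]: "comp X w \<in> layer G w"
  using comp_props by blast

lemma sum_comp: "(\<Sum>w\<in>weights G. comp X w) = X"
  using comp_props by metis

lemma comp_unique: "\<lbrakk>\<And>w. c w \<in> layer G w; X = (\<Sum>w\<in>weights G. c w)\<rbrakk> \<Longrightarrow> comp X = c"
  using layer_direct_sum[of X] comp_props[of X] by blast

lemma comp_add: "comp (X + Y) w = comp X w + comp Y w"
proof -
  have "comp (X + Y) = (\<lambda>w. comp X w + comp Y w)"
    by (rule comp_unique) (simp_all add: subspace_add[OF layer_subspace] sum.distrib sum_comp)
  then show ?thesis by simp
qed

lemma comp_scaleR: "comp (r *\<^sub>R X) w = r *\<^sub>R comp X w"
proof -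
  have "comp (r *\<^sub>R X) = (\<lambda>w. r *\<^sub>R comp X w)"
    by (rule comp_unique) (simp_all add: subspace_scale[OF layer_subspace] scaleR_sum_right[symmetric] sum_comp)
  then show ?thesis by simp
qed

lemma linear_comp: "linear (\<lambda>X. comp X w)"
  by (rule linearI) (simp_all add: comp_add comp_scaleR)

lemma bounded_linear_comp: "bounded_linear (\<lambda>X. comp X w)"
  using linear_comp by (simp add: linear_conv_bounded_linear)

lemma comp_notin_weights: "w \<notin> weights G \<Longrightarrow> comp X w = 0"
  using comp_in_layer[of X w] layer_trivial by auto

lemma comp_layer:
  assumes "X \<in> layer G v"
  shows "comp X w = (if w = v then X else 0)"
proof (cases "v \<in> weights G")
  case True
  have "comp X = (\<lambda>w. if w = v then X else 0)"
    using assms True finite_weights by (intro comp_unique) (auto simp: subspace_0[OF layer_subspace])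
  then show ?thesis by simp
next
  case False
  then have "X = 0" using assms layer_trivial by blast
  then show ?thesis using linear_0[OF linear_comp] by auto
qed

lemma comp_dil: "comp (dil r X) w = r ^ w *\<^sub>R comp X w"
proof -
  have "comp (dil r X) = (\<lambda>w. r ^ w *\<^sub>R comp X w)"
    by (rule comp_unique) (simp_all add: algebra_dilation_def subspace_scale[OF layer_subspace])
  then show ?thesis by simp
qed

lemma comp_eqI: "(\<And>w. comp X w = comp Y w) \<Longrightarrow> X = Y"
  by (metis (mono_tags, lifting) sum.cong sum_comp)

lemma dil_dil: "dil r (dil s X) = dil (r * s) X"
  by (rule comp_eqI) (simp add: comp_dil power_mult_distrib)

lemma dil_one [simp]: "dil 1 X = X"
  by (rule comp_eqI) (simp add: comp_dil)

lemma dil_inverse: "r \<noteq> 0 \<Longrightarrow> dil (inverse r) (dil r X) = X" "r \<noteq> 0 \<Longrightarrow> dil r (dil (inverse r) X) = X"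
  by (simp_all add: dil_dil)

lemma linear_dil: "linear (dil r)"
  by (rule linearI; rule comp_eqI) (simp_all add: comp_dil comp_add comp_scaleR scaleR_add_right)

lemma dil_layer: "X \<in> layer G w \<Longrightarrow> dil r X = r ^ w *\<^sub>R X"
  by (rule comp_eqI) (simp add: comp_dil comp_layer comp_scaleR)

lemma zero_notin_weights: "0 \<notin> weights G"
  using weights_pos by blast

text \<open>Positivity of the weights is essential: a layer of weight 0 would be multiplied by
  \<open>0 ^ 0 = 1\<close>. The value at \<open>r = 0\<close> lets dilations contract every vector
  continuously to the identity.\<close>

lemma dil_zero [simp]: "dil 0 X = 0"
  by (rule comp_eqI)
    (metis (no_types, lifting) comp_dil comp_notin_weights linear_0[OF linear_comp] power_0_left
      scaleR_zero_left scaleR_zero_right zero_notin_weights)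

lemma continuous_on_dil [continuous_intros]:
  assumes "continuous_on S f" "continuous_on S g"
  shows "continuous_on S (\<lambda>x. dil (f x) (g x))"
proof -
  have "continuous_on S (\<lambda>x. comp (g x) w)" for w
    using continuous_on_compose2[OF linear_continuous_on[OF bounded_linear_comp] assms(2)] by blast
  then show ?thesis unfolding algebra_dilation_def by (intro continuous_intros assms(1))
qed

end

section \<open>The homogeneous norm and its comparison with the Euclidean norm\<close>

locale homogeneous_metric_group = positively_graded_group G
  for G :: "('g, 'a::euclidean_space, 'm) graded_lie_group_scheme" (structure) +
  fixes d :: "'g \<Rightarrow> 'g \<Rightarrow> real"
  assumes homogeneous_distance: "homogeneous_distance G d"
begin

definition hnorm :: "'a \<Rightarrow> real" where
  "hnorm X = d \<one> (expmap G X)"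

sublocale Metric_space "carrier G" d
  using homogeneous_distance by (simp add: homogeneous_distance_def)

lemma dist_exp: "d (expmap G X) (expmap G Y) = hnorm (- X \<star> Y)"
proof -
  have "d (z \<otimes> x) (z \<otimes> y) = d x y" if "x \<in> carrier G" "y \<in> carrier G" "z \<in> carrier G" for x y z
    using homogeneous_distance that by (simp add: homogeneous_distance_def)
  from this[of "expmap G X" "expmap G Y" "inv (expmap G X)"] show ?thesis by (simp add: hnorm_def exp_star exp_minus)
qed

lemma hnorm_nonneg [simp]: "0 \<le> hnorm X"
  by (simp add: hnorm_def)

lemma hnorm_eq_0 [simp]: "hnorm X = 0 \<longleftrightarrow> X = 0"
  unfolding hnorm_def using zero[of \<one> "expmap G X"] exp_zero exp_inj by (metis exp_closed one_closed)

lemma hnorm_zero [simp]: "hnorm 0 = 0"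
  by simp

lemma hnorm_minus [simp]: "hnorm (- X) = hnorm X"
  using dist_exp[of X 0] dist_exp[of 0 X] commute by simp

lemma hnorm_star: "hnorm (X \<star> Y) \<le> hnorm X + hnorm Y"
  using triangle[of "expmap G (- X)" "expmap G 0" "expmap G Y"] dist_exp[of "- X" Y] dist_exp[of "- X" 0]
    dist_exp[of 0 Y] by simp

lemma hnorm_diff: "\<bar>hnorm Y - hnorm X\<bar> \<le> hnorm (- X \<star> Y)"
  using hnorm_star[of X "- X \<star> Y"] hnorm_star[of Y "- Y \<star> X"] hnorm_minus[of "- X \<star> Y"]
  by (simp add: minus_star)

lemma dist_dil:
  assumes "r > 0"
  shows "hnorm (- dil r X \<star> dil r Y) = r * hnorm (- X \<star> Y)"
proof -
  have "d (dilation G r (expmap G X)) (dilation G r (expmap G Y)) = r * d (expmap G X) (expmap G Y)"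
    using homogeneous_distance assms by (simp add: homogeneous_distance_def)
  then show ?thesis by (simp add: dilation_def dist_exp)
qed

lemma hnorm_dil: "r > 0 \<Longrightarrow> hnorm (dil r X) = r * hnorm X"
  using dist_dil[of r 0 X] by (simp add: linear_0[OF linear_dil])

text \<open>Up to sign, a scalar multiple of a vector in one layer is a dilation of it, and group
  inversion absorbs the sign.\<close>

lemma hnorm_layer:
  assumes "X \<in> layer G w" "w > 0"
  shows "hnorm (t *\<^sub>R X) = root w \<bar>t\<bar> * hnorm X"
proof (cases "t = 0")
  case False
  let ?r = "root w \<bar>t\<bar>"
  have r: "?r > 0" using False assms(2) by simp
  have "dil ?r X = \<bar>t\<bar> *\<^sub>R X" using dil_layer[OF assms(1)] assms(2) by simp
  then have "hnorm (\<bar>t\<bar> *\<^sub>R X) = ?r * hnorm X" using hnorm_dil[OF r] by metis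
  moreover have "hnorm (\<bar>t\<bar> *\<^sub>R X) = hnorm (t *\<^sub>R X)"
    using hnorm_minus[of "t *\<^sub>R X"] by (cases "t \<ge> 0") auto
  ultimately show ?thesis by simp
qed simp

lemma ex_adapted_basis:
  "\<exists>B. independent B \<and> span B = (UNIV :: 'a set) \<and> B \<subseteq> (\<Union>w\<in>weights G. layer G w)"
proof -
  obtain B where B: "B \<subseteq> (\<Union>w\<in>weights G. layer G w)" "independent B"
      "(\<Union>w\<in>weights G. layer G w) \<subseteq> span B"
    using maximal_independent_subset by blast
  have "X \<in> span B" for X
  proof -
    have "(\<Sum>w\<in>weights G. comp X w) \<in> span B"
      using B(3) comp_in_layer by (intro span_sum) blast
    then show ?thesis by (simp add: sum_comp)
  qed
  then show ?thesis using B by blast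
qed

text \<open>The product of exponentials along an adapted basis covers a neighbourhood of the identity,
  and along each basis vector \<open>hnorm\<close> is a root of the coordinate.\<close>

lemma hnorm_small: "\<epsilon> > 0 \<Longrightarrow> \<exists>\<delta>>0. \<forall>X. norm X < \<delta> \<longrightarrow> hnorm X < \<epsilon>"
proof -
  assume \<epsilon>: "\<epsilon> > 0"
  obtain B where B: "independent B" "span B = (UNIV :: 'a set)" "B \<subseteq> (\<Union>w\<in>weights G. layer G w)"
    using ex_adapted_basis by blast
  have finB: "finite B" using B(1) independent_imp_finite by blast
  define c where "c b X = representation B X b" for b X
  have lc: "linear (c b)" for b
    unfolding c_def using B by (intro linearI) (simp_all add: representation_add representation_scale)
  have blc: "bounded_linear (c b)" for b using lc by (simp add: linear_conv_bounded_linear)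
  obtain xs where xs: "set xs = B" "distinct xs" using finite_distinct_list[OF finB] by blast
  define \<Phi> where "\<Phi> ys X = foldr (\<lambda>b Y. (c b X *\<^sub>R b) \<star> Y) ys 0" for ys X
  have \<Phi>0: "\<Phi> ys 0 = 0" for ys
    by (induction ys) (simp_all add: \<Phi>_def linear_0[OF lc])
  have der: "(\<Phi> ys has_derivative (\<lambda>h. \<Sum>b\<leftarrow>ys. c b h *\<^sub>R b)) (at 0)" for ys
  proof (induction ys)
    case (Cons b ys)
    have "((\<lambda>X. c b X *\<^sub>R b) has_derivative (\<lambda>h. c b h *\<^sub>R b)) (at 0)"
      using bounded_linear_imp_has_derivative[OF blc] by (auto intro!: derivative_eq_intros)
    from star_has_derivative_at_zero[OF this Cons] show ?case
      by (simp add: \<Phi>_def[of "b # ys"] \<Phi>_def[symmetric] \<Phi>0 linear_0[OF lc])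
  qed (simp add: \<Phi>_def)
  \<comment> \<open>The factors run through a whole basis with its own coordinates, so the
    derivative of the product at 0 is the identity.\<close>
  have "(\<lambda>h. \<Sum>b\<leftarrow>xs. c b h *\<^sub>R b) = id"
    using B finB sum_representation_eq[of B _ B]
    by (auto simp: c_def xs sum_list_distinct_conv_sum_set[OF xs(2)])
  then have der': "(\<Phi> xs has_derivative id) (at 0)" using der[of xs] by simp
  have cont: "continuous_on UNIV (\<Phi> ys)" for ys
  proof (induction ys)
    case (Cons b ys)
    have "continuous_on UNIV (\<lambda>X. (c b X *\<^sub>R b) \<star> \<Phi> ys X)"
      using linear_continuous_on[OF blc] by (intro continuous_intros Cons)
    then show ?case by (simp add: \<Phi>_def)
  qed (simp add: \<Phi>_def)
  have le: "hnorm (\<Phi> ys X) \<le> (\<Sum>b\<leftarrow>ys. hnorm (c b X *\<^sub>R b))" for ys X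
  proof (induction ys)
    case (Cons b ys)
    show ?case using hnorm_star[of "c b X *\<^sub>R b" "\<Phi> ys X"] Cons by (simp add: \<Phi>_def)
  qed (simp add: \<Phi>_def)
  have "((\<lambda>X. hnorm (c b X *\<^sub>R b)) \<longlongrightarrow> 0) (at 0)" if "b \<in> B" for b
  proof -
    from B(3) that obtain w where w: "w \<in> weights G" "b \<in> layer G w" by blast
    have t: "(c b \<longlongrightarrow> c b 0) (at 0)"
      using linear_continuous_at[OF blc] unfolding isCont_def .
    have "((\<lambda>X. root w \<bar>c b X\<bar> * hnorm b) \<longlongrightarrow> root w \<bar>c b 0\<bar> * hnorm b) (at 0)"
      by (rule tendsto_mult[OF tendsto_real_root[OF tendsto_rabs[OF t]] tendsto_const])
    then show ?thesis using hnorm_layer[OF w(2) weights_pos[OF w(1)]] by (simp add: linear_0[OF lc])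
  qed
  then have "((\<lambda>X. \<Sum>b\<in>B. hnorm (c b X *\<^sub>R b)) \<longlongrightarrow> (\<Sum>b\<in>B. 0)) (at 0)"
    by (intro tendsto_sum)
  then have "\<forall>\<^sub>F X in at 0. dist (\<Sum>b\<in>B. hnorm (c b X *\<^sub>R b)) 0 < \<epsilon>"
    using tendstoD[OF _ \<epsilon>, of "\<lambda>X. \<Sum>b\<in>B. hnorm (c b X *\<^sub>R b)" 0 "at 0"] by simp
  then have "\<exists>\<rho>>0. \<forall>X\<in>UNIV. X \<noteq> 0 \<and> dist X 0 < \<rho> \<longrightarrow> dist (\<Sum>b\<in>B. hnorm (c b X *\<^sub>R b)) 0 < \<epsilon>"
    by (simp only: eventually_at)
  then obtain \<rho> where \<rho>0: "\<rho> > 0"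
      "\<And>X. \<lbrakk>X \<noteq> 0; norm X < \<rho>\<rbrakk> \<Longrightarrow> \<bar>\<Sum>b\<in>B. hnorm (c b X *\<^sub>R b)\<bar> < \<epsilon>"
    by auto
  have \<rho>: "(\<Sum>b\<in>B. hnorm (c b X *\<^sub>R b)) < \<epsilon>" if "X \<noteq> 0" "norm X < \<rho>" for X
    using \<rho>0(2)[OF that] by linarith
  have small: "hnorm (\<Phi> xs X) < \<epsilon>" if "norm X < \<rho>" for X
  proof (cases "X = 0")
    case False
    then show ?thesis using le[of xs X] \<rho>[OF False that]
      by (simp add: sum_list_distinct_conv_sum_set[OF xs(2)] xs(1))
  qed (simp add: \<Phi>0 \<epsilon>)
  \<comment> \<open>Continuity together with an invertible derivative at the single point 0 makes
    the image a neighbourhood of 0. Every short vector is thus \<open>\<Phi> xs\<close> of one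
    shorter than \<rho>, where \<open>small\<close> applies.\<close>
  have "\<Phi> xs 0 \<in> interior (\<Phi> xs ` ball 0 \<rho>)"
    using \<rho>0(1) by (intro sussmann_open_mapping[OF open_UNIV cont _ der' bounded_linear_ident]) (auto simp: id_def)
  then obtain \<delta> where "\<delta> > 0" "ball 0 \<delta> \<subseteq> \<Phi> xs ` ball 0 \<rho>"
    by (metis \<Phi>0 mem_interior)
  moreover have "hnorm X < \<epsilon>" if "X \<in> \<Phi> xs ` ball 0 \<rho>" for X
    using that small by auto
  ultimately show ?thesis by (meson mem_ball_0 subsetD)
qed

text \<open>Left translation carries the estimate near the identity to any point, through the
  reverse triangle inequality \<open>hnorm_diff\<close>.\<close>

lemma tendsto_hnorm [tendsto_intros]:
  assumes "(f \<longlongrightarrow> a) F"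
  shows "((\<lambda>x. hnorm (f x)) \<longlongrightarrow> hnorm a) F"
  unfolding tendsto_iff
proof (intro allI impI)
  fix \<epsilon> :: real assume "\<epsilon> > 0"
  then obtain \<delta> where \<delta>: "\<delta> > 0" "\<And>X. norm X < \<delta> \<Longrightarrow> hnorm X < \<epsilon>" using hnorm_small by blast
  have "((\<lambda>x. - a \<star> f x) \<longlongrightarrow> - a \<star> a) F" by (intro tendsto_intros assms)
  then have "\<forall>\<^sub>F x in F. norm (- a \<star> f x) < \<delta>" using \<delta>(1) by (simp add: tendsto_iff dist_norm)
  then show "\<forall>\<^sub>F x in F. dist (hnorm (f x)) (hnorm a) < \<epsilon>"
    by eventually_elim (use \<delta>(2) hnorm_diff in \<open>auto simp: dist_real_def intro: le_less_trans\<close>)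
qed

lemma continuous_on_hnorm [continuous_intros]:
  "continuous_on S f \<Longrightarrow> continuous_on S (\<lambda>x. hnorm (f x))"
  unfolding continuous_on_def by (auto intro: tendsto_intros)

text \<open>The constant is the minimum of \<open>hnorm\<close> on the Euclidean unit sphere. A
  vector outside the open unit ball is brought onto the sphere by a dilation of ratio at most 1,
  which cannot increase \<open>hnorm\<close>.\<close>

lemma ex_hnorm_ball_in_unit_ball: "\<exists>m>0. \<forall>X. hnorm X < m \<longrightarrow> norm X < 1"
proof -
  have "compact (sphere (0::'a) 1)" by simp
  moreover have "sphere (0::'a) 1 \<noteq> {}" by simp
  moreover have "continuous_on (sphere 0 1) hnorm"
    using continuous_on_hnorm[OF continuous_on_id] by simp
  ultimately obtain z where z: "z \<in> sphere 0 1" "\<And>X. X \<in> sphere 0 1 \<Longrightarrow> hnorm z \<le> hnorm X"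
    using continuous_attains_inf[of "sphere 0 1" hnorm] by metis
  have "z \<noteq> 0" using z(1) by auto
  then have pos: "hnorm z > 0" using hnorm_nonneg[of z] hnorm_eq_0[of z] by linarith
  have "norm X < 1" if "hnorm X < hnorm z" for X
  proof (rule ccontr)
    assume "\<not> norm X < 1"
    then have "1 \<le> norm X" by simp
    then have "norm (dil 0 X) \<le> 1" "1 \<le> norm (dil 1 X)" by simp_all
    moreover have "continuous_on {0..1} (\<lambda>r. norm (dil r X))" by (intro continuous_intros)
    ultimately obtain r where r: "0 \<le> r" "r \<le> 1" "norm (dil r X) = 1"
      using IVT'[of "\<lambda>r. norm (dil r X)" 0 1 1] by auto
    then have "r > 0" using dil_zero[of X] by (cases "r = 0") auto
    then have "hnorm z \<le> r * hnorm X" using z(2)[of "dil r X"] r(3) hnorm_dil by simp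
    also have "\<dots> \<le> hnorm X" using r(2) using r(1) by (simp add: mult_left_le_one_le)
    finally show False using that by simp
  qed
  then show ?thesis using pos by blast
qed

text \<open>Dilate \<open>X\<close> to \<open>hnorm\<close> equal to \<open>m / 2\<close>, where the
  Euclidean norm is below 1, and undo the dilation: it acts on the component of weight
  \<open>w\<close> by the \<open>w\<close>-th power of the ratio.\<close>

lemma norm_comp_le_hnorm_power: "\<exists>K\<ge>0. \<forall>X. norm (comp X w) \<le> K * hnorm X ^ w"
proof -
  obtain m where m: "m > 0" "\<And>X. hnorm X < m \<Longrightarrow> norm X < 1"
    using ex_hnorm_ball_in_unit_ball by blast
  obtain K where K: "K \<ge> 0" "\<And>X. norm (comp X w) \<le> norm X * K"
    using bounded_linear.nonneg_bounded[OF bounded_linear_comp] by blast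
  have "norm (comp X w) \<le> (K * (2 / m) ^ w) * hnorm X ^ w" for X
  proof (cases "X = 0")
    case True
    then show ?thesis using linear_0[OF linear_comp] K(1) m(1) by simp
  next
    case False
    then have pos: "hnorm X > 0" using hnorm_nonneg[of X] hnorm_eq_0[of X] by linarith
    define r where "r = m / (2 * hnorm X)"
    have r: "r > 0" using pos m(1) by (simp add: r_def)
    have "hnorm (dil r X) = m / 2" using False by (simp add: hnorm_dil[OF r]) (simp add: r_def)
    then have "norm (dil r X) < 1" using m by simp
    then have "norm (comp (dil r X) w) \<le> K"
      using K(2)[of "dil r X"] mult_right_mono[of "norm (dil r X)" 1 K] K(1) by linarith
    then have "r ^ w * norm (comp X w) \<le> K" using r by (simp add: comp_dil)
    then have "norm (comp X w) \<le> K / r ^ w" using r by (simp add: field_simps)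
    also have "\<dots> = (K * (2 / m) ^ w) * hnorm X ^ w"
      by (simp add: r_def power_divide power_mult_distrib)
    finally show ?thesis .
  qed
  then show ?thesis using K(1) m(1) by (intro exI[of _ "K * (2 / m) ^ w"]) simp
qed

lemma tendsto_zero_if_hnorm:
  assumes "((\<lambda>x. hnorm (f x)) \<longlongrightarrow> 0) F"
  shows "(f \<longlongrightarrow> 0) F"
proof -
  have "((\<lambda>x. comp (f x) w) \<longlongrightarrow> 0) F" if w: "w \<in> weights G" for w
  proof -
    obtain K where K: "\<And>X. norm (comp X w) \<le> K * hnorm X ^ w"
      using norm_comp_le_hnorm_power by blast
    have "((\<lambda>x. K * hnorm (f x) ^ w) \<longlongrightarrow> K * 0 ^ w) F" by (intro tendsto_intros assms)
    then have "((\<lambda>x. K * hnorm (f x) ^ w) \<longlongrightarrow> 0) F" using weights_pos[OF w] by (simp add: power_0_left)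
    then show ?thesis by (rule Lim_null_comparison[OF always_eventually, rotated]) (use K in auto)
  qed
  then have "((\<lambda>x. \<Sum>w\<in>weights G. comp (f x) w) \<longlongrightarrow> (\<Sum>w\<in>weights G. 0)) F"
    by (intro tendsto_sum)
  then show ?thesis by (simp add: sum_comp)
qed

lemma bounded_hnorm_ball: "bounded {X. hnorm X \<le> C}"
proof -
  obtain m where m: "m > 0" "\<And>X. hnorm X < m \<Longrightarrow> norm X < 1"
    using ex_hnorm_ball_in_unit_ball by blast
  \<comment> \<open>The ratio \<open>r\<close> brings the ball into the region of Euclidean norm
    below 1. The term \<open>\<bar>C\<bar> + 1\<close> keeps the denominator positive for every
    \<open>C\<close>.\<close>
  define r where "r = m / (2 * (\<bar>C\<bar> + 1))"
  have r: "r > 0" using m(1) by (simp add: r_def)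
  have "{X. hnorm X \<le> C} \<subseteq> dil (inverse r) ` ball 0 1"
  proof
    fix X assume "X \<in> {X. hnorm X \<le> C}"
    then have "r * hnorm X \<le> r * (\<bar>C\<bar> + 1)" using r by auto
    also have "\<dots> = m / 2" by (simp add: r_def field_simps add_nonneg_eq_0_iff)
    finally have "hnorm (dil r X) < m" using m(1) hnorm_dil[OF r] by simp
    then have "dil r X \<in> ball 0 1" using m(2) by simp
    moreover have "X = dil (inverse r) (dil r X)" using r by (simp add: dil_inverse)
    ultimately show "X \<in> dil (inverse r) ` ball 0 1" by blast
  qed
  moreover have "bounded (dil (inverse r) ` ball 0 1)"
    using linear_dil by (intro bounded_linear_image) (auto simp: linear_conv_bounded_linear)
  ultimately show ?thesis using bounded_subset by blast
qed

end

section \<open>Closed homogeneous subgroups are graded linear subspaces in the chart\<close>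

context positively_graded_group
begin

text \<open>Linearity is deliberately absent; it is a consequence, obtained in
  \<open>log_subgroup_subspace\<close>.\<close>

definition homogeneous_log_subgroup :: "'a set \<Rightarrow> bool" where
  "homogeneous_log_subgroup L \<longleftrightarrow> closed L \<and> 0 \<in> L \<and> (\<forall>X\<in>L. \<forall>Y\<in>L. X \<star> Y \<in> L) \<and>
     (\<forall>X\<in>L. - X \<in> L) \<and> (\<forall>r>0. \<forall>X\<in>L. dil r X \<in> L)"

lemma homogeneous_log_subgroup_log_image:
  assumes "homogeneous_subgroup G H"
  shows "homogeneous_log_subgroup (logmap G ` H)"
proof -
  have H: "subgroup H G" "closed (logmap G ` H)" "\<And>r. r > 0 \<Longrightarrow> dilation G r ` H \<subseteq> H"
    using assms by (auto simp: homogeneous_subgroup_def)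
  have car: "x \<in> carrier G" if "x \<in> H" for x using H(1) that subgroup.mem_carrier by fast
  have 1: "logmap G x \<star> logmap G y \<in> logmap G ` H" if "x \<in> H" "y \<in> H" for x y
    using subgroup.m_closed[OF H(1) that] log_mult[OF car[OF that(1)] car[OF that(2)]] by (metis imageI)
  have 2: "- logmap G x \<in> logmap G ` H" if "x \<in> H" for x
    using subgroup.m_inv_closed[OF H(1) that] log_inv[OF car[OF that]] by (metis imageI)
  have 3: "dil r (logmap G x) \<in> logmap G ` H" if "r > 0" "x \<in> H" for r x
  proof -
    have "dilation G r x \<in> H" using H(3)[OF that(1)] that(2) by blast
    moreover have "logmap G (dilation G r x) = dil r (logmap G x)" by (simp add: dilation_def)
    ultimately show ?thesis by (metis imageI)
  qed
  have 4: "0 \<in> logmap G ` H" using subgroup.one_closed[OF H(1)] log_one by (metis imageI)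
  show ?thesis unfolding homogeneous_log_subgroup_def using H(2) 1 2 3 4 by blast
qed

context
  fixes L :: "'a set"
  assumes L: "homogeneous_log_subgroup L"
begin

lemma log_subgroup_simps:
  "closed L" "0 \<in> L" "\<lbrakk>X \<in> L; Y \<in> L\<rbrakk> \<Longrightarrow> X \<star> Y \<in> L" "X \<in> L \<Longrightarrow> - X \<in> L"
  "\<lbrakk>r > 0; X \<in> L\<rbrakk> \<Longrightarrow> dil r X \<in> L"
  using L by (simp_all add: homogeneous_log_subgroup_def)

lemma log_subgroup_int_multiple:
  assumes "X \<in> L"
  shows "real_of_int m *\<^sub>R X \<in> L"
proof -
  have nat: "real n *\<^sub>R X \<in> L" for n
  proof (induction n)
    case (Suc n)
    have "(real n *\<^sub>R X) \<star> (1 *\<^sub>R X) \<in> L" using log_subgroup_simps(3)[OF Suc assms] by simp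
    then have "(real n + 1) *\<^sub>R X \<in> L" by (simp only: star_scaleR)
    then show ?case by (simp only: of_nat_Suc add.commute)
  qed (simp add: log_subgroup_simps)
  show ?thesis
  proof (cases "m \<ge> 0")
    case True
    then show ?thesis using nat[of "nat m"] by simp
  next
    case False
    then show ?thesis using log_subgroup_simps(4)[OF nat[of "nat (- m)"]] by simp
  qed
qed

text \<open>Integer multiples in the chart are powers in the group, so they stay in
  \<open>L\<close>. Taking \<open>\<lfloor>t / \<epsilon> n\<rfloor>\<close> times
  \<open>h n\<close> approximates \<open>t *\<^sub>R Y\<close>, and \<open>L\<close> is
  closed.\<close>

lemma log_subgroup_tangent:
  assumes h: "\<And>n. h n \<in> L" and \<epsilon>: "\<And>n. \<epsilon> n > 0" "\<epsilon> \<longlonglongrightarrow> 0"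
    and lim: "(\<lambda>n. h n /\<^sub>R \<epsilon> n) \<longlonglongrightarrow> Y"
  shows "t *\<^sub>R Y \<in> L"
proof -
  define m where "m n = \<lfloor>t / \<epsilon> n\<rfloor>" for n
  have "\<bar>real_of_int (m n) * \<epsilon> n - t\<bar> \<le> \<epsilon> n" for n
  proof -
    have "\<bar>real_of_int (m n) - t / \<epsilon> n\<bar> \<le> 1" unfolding m_def by linarith
    then have "\<bar>real_of_int (m n) - t / \<epsilon> n\<bar> * \<epsilon> n \<le> 1 * \<epsilon> n" using \<epsilon>(1)[of n] by (intro mult_right_mono) auto
    moreover have "\<bar>real_of_int (m n) - t / \<epsilon> n\<bar> * \<epsilon> n = \<bar>(real_of_int (m n) - t / \<epsilon> n) * \<epsilon> n\<bar>"
      using \<epsilon>(1)[of n] by (simp add: abs_mult)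
    moreover have "(real_of_int (m n) - t / \<epsilon> n) * \<epsilon> n = real_of_int (m n) * \<epsilon> n - t"
      using \<epsilon>(1)[of n] by (simp add: field_simps)
    ultimately show ?thesis by simp
  qed
  then have "(\<lambda>n. real_of_int (m n) * \<epsilon> n - t) \<longlonglongrightarrow> 0"
    by (intro Lim_null_comparison[OF always_eventually \<epsilon>(2)]) auto
  then have "(\<lambda>n. real_of_int (m n) * \<epsilon> n) \<longlonglongrightarrow> t" by (simp add: LIM_zero_iff)
  from tendsto_scaleR[OF this lim] have "(\<lambda>n. (real_of_int (m n) * \<epsilon> n) *\<^sub>R (h n /\<^sub>R \<epsilon> n)) \<longlonglongrightarrow> t *\<^sub>R Y" .
  moreover have "(real_of_int (m n) * \<epsilon> n) *\<^sub>R (h n /\<^sub>R \<epsilon> n) = real_of_int (m n) *\<^sub>R h n" for n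
    using \<epsilon>(1)[of n] by simp
  ultimately have "(\<lambda>n. real_of_int (m n) *\<^sub>R h n) \<longlonglongrightarrow> t *\<^sub>R Y" by (simp only:)
  then show ?thesis
    by (rule closed_sequentially[OF log_subgroup_simps(1), rotated])
      (use h log_subgroup_int_multiple in blast)
qed

text \<open>Cartan's argument: the one-parameter subgroups inside \<open>L\<close> form a linear subspace, and near the
  identity \<open>L\<close> contains nothing else; dilations make this global.\<close>

lemma log_subgroup_subspace: "subspace L"
proof -
  define H where "H = {X. \<forall>t. t *\<^sub>R X \<in> L}"
  have HL: "H \<subseteq> L"
  proof
    fix X assume "X \<in> H"
    then have "1 *\<^sub>R X \<in> L" unfolding H_def by blast
    then show "X \<in> L" by simp
  qed
  have Hscale: "r *\<^sub>R X \<in> H" if "X \<in> H" for r X using that by (simp add: H_def)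
  have "X + Y \<in> H" if XY: "X \<in> H" "Y \<in> H" for X Y
  proof -
    \<comment> \<open>To first order at the identity the group product is addition, so these
      products of elements of \<open>L\<close> have tangent direction \<open>X + Y\<close>.\<close>
    define h where "h n = (inverse (real (Suc n)) *\<^sub>R X) \<star> (inverse (real (Suc n)) *\<^sub>R Y)" for n
    have hL: "h n \<in> L" for n
      unfolding h_def using XY by (intro log_subgroup_simps(3)) (auto simp: H_def)
    have der: "((\<lambda>t. (t *\<^sub>R X) \<star> (t *\<^sub>R Y)) has_derivative (\<lambda>t. t *\<^sub>R X + t *\<^sub>R Y)) (at 0)"
      by (rule star_has_derivative_at_zero) (auto intro!: derivative_eq_intros)
    have "(\<lambda>n. inverse (real (Suc n)) /\<^sub>R inverse (real (Suc n))) \<longlonglongrightarrow> 1" by simp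
    from has_derivative_sequential_quotient[OF der _ LIMSEQ_inverse_real_of_nat this]
    have "(\<lambda>n. h n /\<^sub>R inverse (real (Suc n))) \<longlonglongrightarrow> X + Y" by (simp add: h_def)
    from log_subgroup_tangent[OF hL _ LIMSEQ_inverse_real_of_nat this] show ?thesis
      by (simp add: H_def)
  qed
  with Hscale log_subgroup_simps(2) have subH: "subspace H"
    by (intro subspaceI) (auto simp: H_def)
  have tan: "Y \<in> H" if "\<And>n. h n \<in> L" "\<And>n. \<epsilon> n > 0" "\<epsilon> \<longlonglongrightarrow> 0" "(\<lambda>n. h n /\<^sub>R \<epsilon> n) \<longlonglongrightarrow> Y" for h \<epsilon> Y
    using log_subgroup_tangent[OF that] by (simp add: H_def)
  obtain B where B: "B \<subseteq> H" "pairwise Linear_Algebra.orthogonal B" "\<And>e. e \<in> B \<Longrightarrow> norm e = 1"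
    "independent B" "span B = H"
    using orthonormal_basis_subspace[OF subH] by metis
  have finB: "finite B" using B(4) independent_imp_finite by blast
  define P where "P X = (\<Sum>e\<in>B. inner X e *\<^sub>R e)" for X
  have PH: "P X \<in> H" for X
    unfolding P_def B(5)[symmetric] by (intro span_sum span_mul span_base)
  have blP: "bounded_linear P"
    unfolding P_def by (intro bounded_linear_sum bounded_linear_scaleR_const bounded_linear_inner_left)
  have P_id: "P X = X" if "X \<in> H" for X
    using orthonormal_expansion[OF B(2,3) finB] that B(5) by (simp add: P_def)
  \<comment> \<open>Otherwise elements of \<open>L\<close> in the kernel of \<open>P\<close> would
    tend to 0. A limit of their normalised directions is a unit vector that lies in \<open>H\<close>
    by \<open>tan\<close> and is still killed by \<open>P\<close>, although \<open>P\<close> is the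
    identity on \<open>H\<close>.\<close>
  have near: "\<exists>\<epsilon>>0. \<forall>Y\<in>L. P Y = 0 \<and> norm Y < \<epsilon> \<longrightarrow> Y = 0"
  proof (rule ccontr)
    assume "\<not> (\<exists>\<epsilon>>0. \<forall>Y\<in>L. P Y = 0 \<and> norm Y < \<epsilon> \<longrightarrow> Y = 0)"
    then have "\<exists>Y. Y \<in> L \<and> P Y = 0 \<and> norm Y < inverse (real (Suc n)) \<and> Y \<noteq> 0" for n
      by (metis inverse_positive_iff_positive of_nat_0_less_iff zero_less_Suc)
    then obtain y where y: "\<And>n. y n \<in> L" "\<And>n. P (y n) = 0" "\<And>n. norm (y n) < inverse (real (Suc n))"
      "\<And>n. y n \<noteq> 0" by metis
    have "\<forall>n. y n /\<^sub>R norm (y n) \<in> sphere 0 1" using y(4) by simp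
    from seq_compactE[OF compact_imp_seq_compact[OF compact_sphere] this]
    obtain Z \<rho> where Z: "Z \<in> sphere 0 1" "strict_mono \<rho>"
        "((\<lambda>n. y n /\<^sub>R norm (y n)) \<circ> \<rho>) \<longlonglongrightarrow> Z" .
    have "(\<lambda>n. norm (y n)) \<longlonglongrightarrow> 0"
      by (rule Lim_null_comparison[OF always_eventually LIMSEQ_inverse_real_of_nat])
        (use y(3) less_imp_le in auto)
    from LIMSEQ_subseq_LIMSEQ[OF this Z(2)] have "(\<lambda>n. norm (y (\<rho> n))) \<longlonglongrightarrow> 0" by (simp add: o_def)
    then have "Z \<in> H"
      using tan[of "\<lambda>n. y (\<rho> n)" "\<lambda>n. norm (y (\<rho> n))" Z] y(1,4) Z(3) by (simp add: o_def)
    moreover have "P (y n /\<^sub>R norm (y n)) = 0" for n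
      using y(2) linear_scale[OF bounded_linear.linear[OF blP]] by simp
    then have "(\<lambda>n. 0) \<longlonglongrightarrow> P Z"
      using bounded_linear.tendsto[OF blP Z(3)] by (simp add: o_def)
    then have "P Z = 0" using LIMSEQ_unique tendsto_const by blast
    ultimately show False using P_id Z(1) by auto
  qed
  then obtain \<epsilon> where \<epsilon>: "\<epsilon> > 0" "\<And>Y. \<lbrakk>Y \<in> L; P Y = 0; norm Y < \<epsilon>\<rbrakk> \<Longrightarrow> Y = 0" by blast
  define Q where "Q X = X - P X" for X
  have blQ: "bounded_linear Q" unfolding Q_def by (intro bounded_linear_sub bounded_linear_ident blP)
  have PQ: "P (Q X) = 0" for X
    unfolding Q_def using linear_diff[OF bounded_linear.linear[OF blP]] P_id[OF PH] by simp
  \<comment> \<open>This splits a vector into a factor in \<open>H\<close> and one orthogonal to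
    \<open>H\<close>. Its derivative at 0 is the identity, so it reaches all points near 0.\<close>
  define \<Phi> where "\<Phi> X = P X \<star> Q X" for X
  have P0: "P 0 = 0" and Q0: "Q 0 = 0"
    using linear_0 bounded_linear.linear blP blQ by blast+
  have "(\<Phi> has_derivative (\<lambda>h. P h + Q h)) (at 0)"
    unfolding \<Phi>_def
    by (intro star_has_derivative_at_zero bounded_linear_imp_has_derivative blP blQ P0 Q0)
  then have der: "(\<Phi> has_derivative (\<lambda>h. h)) (at 0)" by (simp add: Q_def)
  have contQ: "continuous (at 0) Q" using linear_continuous_at[OF blQ] .
  then have "\<forall>e>0. \<exists>\<rho>>0. \<forall>X. norm X < \<rho> \<longrightarrow> norm (Q X) < e"
    by (simp add: continuous_at_eps_delta dist_norm Q0)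
  then obtain \<rho> where \<rho>: "\<rho> > 0" "\<And>X. norm X < \<rho> \<Longrightarrow> norm (Q X) < \<epsilon>"
    using \<epsilon>(1) by blast
  have "continuous_on UNIV \<Phi>" unfolding \<Phi>_def
    by (intro continuous_intros linear_continuous_on blP blQ)
  then have "\<Phi> 0 \<in> interior (\<Phi> ` ball 0 \<rho>)"
    using \<rho>(1) by (intro sussmann_open_mapping[OF open_UNIV _ _ der bounded_linear_ident]) auto
  then obtain \<delta> where \<delta>: "\<delta> > 0" "ball 0 \<delta> \<subseteq> \<Phi> ` ball 0 \<rho>"
    using mem_interior by (metis P0 Q0 \<Phi>_def star_zero(1))
  \<comment> \<open>Cancelling the factor \<open>P Z\<close>, which lies in \<open>L\<close>, leaves
    \<open>Q Z\<close> in \<open>L\<close>; being short and orthogonal to \<open>H\<close>, it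
    vanishes by the choice of \<epsilon>.\<close>
  have loc: "X \<in> H" if "X \<in> L" "norm X < \<delta>" for X
  proof -
    obtain Z where Z: "norm Z < \<rho>" "X = \<Phi> Z" using \<delta>(2) \<open>norm X < \<delta>\<close> by force
    have "Q Z = - P Z \<star> X" using Z(2) by (simp add: \<Phi>_def)
    then have "Q Z \<in> L" using log_subgroup_simps(3,4) PH HL that(1) by (metis subsetD)
    then have "Q Z = 0" using \<epsilon>(2) PQ \<rho>(2) Z(1) by blast
    then show ?thesis using Z(2) PH by (simp add: \<Phi>_def)
  qed
  have dilH: "dil r X \<in> H" if "X \<in> H" "r > 0" for r X
    unfolding H_def
  proof (intro CollectI allI)
    fix t
    have "dil r (t *\<^sub>R X) \<in> L" using that log_subgroup_simps(5) by (simp add: H_def)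
    then show "t *\<^sub>R dil r X \<in> L" by (simp add: linear_scale[OF linear_dil])
  qed
  \<comment> \<open>A small dilation moves any element of \<open>L\<close> into the neighbourhood
    treated in \<open>loc\<close>; the inverse dilation preserves \<open>H\<close>.\<close>
  have "X \<in> H" if "X \<in> L" for X
  proof -
    have "continuous_on {0..} (\<lambda>r. dil r X)" by (intro continuous_intros)
    then obtain s where s: "s > 0" "\<And>r. \<lbrakk>r \<in> {0..}; dist r 0 < s\<rbrakk> \<Longrightarrow> dist (dil r X) (dil 0 X) < \<delta>"
      using \<delta>(1) unfolding continuous_on_iff by (metis atLeast_iff order_refl)
    define r where "r = s / 2"
    have r: "r > 0" "r < s" using s(1) by (simp_all add: r_def)
    have "norm (dil r X) < \<delta>" using s(2)[of r] r by simp
    then have "dil r X \<in> H" using loc log_subgroup_simps(5)[OF r(1) that] by blast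
    from dilH[OF this, of "inverse r"] show ?thesis using r(1) by (simp add: dil_inverse)
  qed
  then have "L = H" using HL by blast
  then show ?thesis using subH by simp
qed

lemma lie_algebra_eq_log_image: "L = logmap G ` H \<Longrightarrow> H \<subseteq> carrier G \<Longrightarrow> lie_algebra G H = L"
proof -
  assume H: "L = logmap G ` H" "H \<subseteq> carrier G"
  have iff: "expmap G X \<in> H \<longleftrightarrow> X \<in> L" for X
  proof
    assume "expmap G X \<in> H"
    then have "logmap G (expmap G X) \<in> L" unfolding H(1) by (rule imageI)
    then show "X \<in> L" by simp
  next
    assume "X \<in> L"
    then obtain x where "x \<in> H" "X = logmap G x" using H(1) by blast
    then show "expmap G X \<in> H" using H(2) by auto
  qed
  show ?thesis unfolding lie_algebra_def iff
  proof (intro equalityI subsetI)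
    fix X assume "X \<in> {X. \<forall>t. t *\<^sub>R X \<in> L}"
    then have "1 *\<^sub>R X \<in> L" by blast
    then show "X \<in> L" by simp
  qed (simp add: subspace_scale[OF log_subgroup_subspace])
qed

text \<open>Elimination by eigenvalues: \<open>dil 2\<close> minus the scalar \<open>2 ^ m\<close>
  removes the summand of weight \<open>m\<close> and multiplies each other one by the nonzero number
  \<open>2 ^ w - 2 ^ m\<close>.\<close>

lemma log_subgroup_layers:
  assumes "finite I" "\<And>w. w \<in> I \<Longrightarrow> c w \<in> layer G w" "sum c I \<in> L"
  shows "\<forall>w\<in>I. c w \<in> L"
  using assms
proof (induction I arbitrary: c rule: finite_induct)
  case (insert m I)
  note sub = log_subgroup_subspace
  have "dil 2 (sum c (insert m I)) - 2 ^ m *\<^sub>R sum c (insert m I) \<in> L"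
    by (intro subspace_diff subspace_scale sub log_subgroup_simps(5) insert.prems) simp
  moreover have "dil 2 (sum c (insert m I)) = (\<Sum>w\<in>insert m I. 2 ^ w *\<^sub>R c w)"
    unfolding linear_sum[OF linear_dil] by (intro sum.cong refl dil_layer insert.prems)
  ultimately have "(\<Sum>w\<in>I. (2 ^ w - 2 ^ m) *\<^sub>R c w) \<in> L"
    using insert.hyps by (simp add: scaleR_add_right scaleR_sum_right scaleR_diff_left sum_subtractf)
  then have "\<forall>w\<in>I. (2 ^ w - 2 ^ m) *\<^sub>R c w \<in> L"
    by (intro insert.IH) (auto intro: subspace_scale[OF layer_subspace] insert.prems)
  then have cI: "c w \<in> L" if "w \<in> I" for w
  proof -
    have "(2 ^ w - 2 ^ m :: real) \<noteq> 0" using that insert.hyps by (auto simp: power_inject_exp)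
    moreover have "(2 ^ w - 2 ^ m) *\<^sub>R c w \<in> L" using \<open>\<forall>w\<in>I. _\<close> that by blast
    ultimately show ?thesis
      using subspace_scale[OF sub, of "(2 ^ w - 2 ^ m) *\<^sub>R c w" "inverse (2 ^ w - 2 ^ m)"] by simp
  qed
  then have "sum c I \<in> L" by (intro subspace_sum[OF sub])
  then have "sum c (insert m I) - sum c I \<in> L" using subspace_diff[OF sub insert.prems(2)] by blast
  then show ?case using cI insert.hyps by simp
qed simp

lemma log_subgroup_comp:
  assumes "X \<in> L"
  shows "comp X w \<in> L"
proof (cases "w \<in> weights G")
  case True
  have "sum (comp X) (weights G) \<in> L" using assms by (simp add: sum_comp)
  from log_subgroup_layers[OF finite_weights _ this] True show ?thesis by simp
next
  case False
  then show ?thesis using comp_notin_weights log_subgroup_simps(2) by simp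
qed

end

end

section \<open>Separation of subgroups and the blow-up of the graph\<close>

context homogeneous_metric_group
begin

text \<open>By homogeneity it suffices to treat \<open>hnorm a = 1\<close>. There the distance to
  bounded \<open>b\<close> attains its minimum by compactness, and the minimum is positive because
  only the identity is common to \<open>L\<close> and \<open>M\<close>.\<close>

lemma log_subgroups_separated:
  assumes L: "homogeneous_log_subgroup L" and M: "homogeneous_log_subgroup M" and LM: "L \<inter> M = {0}"
  shows "\<exists>c>0. \<forall>a\<in>L. \<forall>b\<in>M. c * hnorm a \<le> hnorm (- a \<star> b)"
proof -
  let ?A = "{a. hnorm a = 1} \<inter> L" and ?B = "{b. hnorm b \<le> 2} \<inter> M"
  have ch: "continuous_on UNIV hnorm" by (intro continuous_intros)
  have "closed {a. hnorm a = 1}" by (intro closed_Collect_eq ch continuous_intros)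
  then have clA: "closed ?A" using log_subgroup_simps(1)[OF L] by (rule closed_Int)
  have "closed {b. hnorm b \<le> 2}" by (intro closed_Collect_le ch continuous_intros)
  then have clB: "closed ?B" using log_subgroup_simps(1)[OF M] by (rule closed_Int)
  have "bounded ?A" "bounded ?B"
    by (rule bounded_subset[OF bounded_hnorm_ball[of 1]] bounded_subset[OF bounded_hnorm_ball[of 2]]; auto)+
  with clA clB have comp: "compact (?A \<times> ?B)"
    by (intro compact_Times) (simp_all add: compact_eq_bounded_closed)
  have cont: "continuous_on (?A \<times> ?B) (\<lambda>p. hnorm (- fst p \<star> snd p))"
    by (intro continuous_intros)
  have "\<exists>c>0. \<forall>p\<in>?A \<times> ?B. c \<le> hnorm (- fst p \<star> snd p)"
  proof (cases "?A \<times> ?B = {}")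
    case True
    then show ?thesis unfolding True by (intro exI[of _ 1]) simp
  next
    case False
    from continuous_attains_inf[OF comp False cont] obtain q where q: "q \<in> ?A \<times> ?B"
      "\<forall>p\<in>?A \<times> ?B. hnorm (- fst q \<star> snd q) \<le> hnorm (- fst p \<star> snd p)" by (rule bexE)
    have "hnorm (- fst q \<star> snd q) \<noteq> 0"
    proof
      assume "hnorm (- fst q \<star> snd q) = 0"
      then have "- fst q \<star> snd q = 0" by simp
      then have "fst q \<star> (- fst q \<star> snd q) = fst q \<star> 0" by (rule arg_cong)
      then have eq: "snd q = fst q" by simp
      have q': "hnorm (fst q) = 1" "fst q \<in> L" "snd q \<in> M" using q(1) by (simp_all add: mem_Times_iff)
      then have "fst q \<in> {0}" unfolding LM[symmetric] eq by blast
      then show False using q'(1) by simp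
    qed
    then have "hnorm (- fst q \<star> snd q) > 0" using hnorm_nonneg by (simp add: less_le)
    then show ?thesis using q(2) by blast
  qed
  then obtain c where c: "c > 0" "\<And>a b. \<lbrakk>a \<in> ?A; b \<in> ?B\<rbrakk> \<Longrightarrow> c \<le> hnorm (- a \<star> b)" by auto
  \<comment> \<open>For \<open>b\<close> outside the compact set, \<open>hnorm b > 2\<close> and
    \<open>hnorm a = 1\<close> leave a distance of at least 1 by the triangle inequality; hence the
    minimum with 1.\<close>
  have unit: "min c 1 \<le> hnorm (- a \<star> b)" if a: "a \<in> ?A" and b: "b \<in> M" for a b
  proof (cases "hnorm b \<le> 2")
    case True
    then show ?thesis using c(2)[OF a, of b] b by auto
  next
    case False
    have "hnorm b \<le> hnorm a + hnorm (- a \<star> b)" using hnorm_star[of a "- a \<star> b"] by simp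
    then show ?thesis using False a by auto
  qed
  have "min c 1 * hnorm a \<le> hnorm (- a \<star> b)" if ab: "a \<in> L" "b \<in> M" for a b
  proof (cases "a = 0")
    case False
    then have pos: "hnorm a > 0" using hnorm_nonneg[of a] hnorm_eq_0[of a] by linarith
    define r where "r = inverse (hnorm a)"
    have r: "r > 0" using pos by (simp add: r_def)
    have "hnorm (dil r a) = 1" using hnorm_dil[OF r] False by (simp add: r_def)
    then have "min c 1 \<le> hnorm (- dil r a \<star> dil r b)"
      using unit[of "dil r a" "dil r b"] log_subgroup_simps(5)[OF L r ab(1)] log_subgroup_simps(5)[OF M r ab(2)]
      by simp
    then have "min c 1 \<le> r * hnorm (- a \<star> b)" by (simp only: dist_dil[OF r])
    then have "min c 1 * hnorm a \<le> (r * hnorm (- a \<star> b)) * hnorm a" using pos by (intro mult_right_mono) auto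
    also have "\<dots> = hnorm (- a \<star> b)" using False by (simp add: r_def)
    finally show ?thesis .
  qed simp
  then show ?thesis using c(1) by (intro exI[of _ "min c 1"]) simp
qed

text \<open>Dilating the graph at scale \<open>r\<close> with \<open>r\<^sup>w\<close> the Euclidean size of the displacement, the
  components of weight above \<open>w\<close> are of order smaller than \<open>r\<^sup>w\<close> and disappear in the limit.\<close>

lemma graph_tangent_blow_up:
  assumes T: "homogeneous_log_subgroup T" and S: "homogeneous_log_subgroup S"
    and \<Omega>: "\<Omega> \<subseteq> T" and g0: "g 0 = 0"
    and der: "(g has_derivative \<tau>) (at 0 within \<Omega>)"
    and transversal: "\<And>Y. \<lbrakk>Y \<in> T; \<tau> Y \<in> S\<rbrakk> \<Longrightarrow> Y = 0"
    and conv: "\<And>Y :: nat \<Rightarrow> 'a. \<lbrakk>\<And>n. Y n \<in> \<Omega>; (\<lambda>n. g (Y n)) \<longlonglongrightarrow> 0\<rbrakk> \<Longrightarrow> Y \<longlonglongrightarrow> 0"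
    and \<delta>: "\<delta> > 0"
    and lift: "\<And>X. \<lbrakk>X \<in> T; norm X < \<delta>\<rbrakk> \<Longrightarrow>
      \<exists>Z\<in>S. \<exists>Y\<in>\<Omega>. X \<star> Z = g Y \<and> hnorm (g Y) \<le> C * hnorm X"
    and X: "X \<in> T" "X \<in> layer G w" and w: "w \<in> weights G"
  shows "\<exists>Y\<in>T. \<tau> Y - X \<in> S \<and> (\<forall>v>w. comp (\<tau> Y) v = 0)"
proof -
  note sT = log_subgroup_subspace[OF T] and sS = log_subgroup_subspace[OF S]
  note clT = log_subgroup_simps(1)[OF T] and clS = log_subgroup_simps(1)[OF S]
  have w0: "w > 0" using weights_pos[OF w] .
  \<comment> \<open>The bound 1 gives \<open>r n ^ w \<le> r n\<close>; the other bound keeps every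
    \<open>t n *\<^sub>R X\<close> in the range of \<open>lift\<close>.\<close>
  define \<rho> where "\<rho> = min 1 (\<delta> / (norm X + 1))"
  have \<rho>: "0 < \<rho>" "\<rho> \<le> 1" "\<rho> * norm X < \<delta>"
  proof -
    have "norm X + 1 > 0" using norm_ge_zero[of X] by linarith
    then show "0 < \<rho>" "\<rho> \<le> 1" using \<delta> by (simp_all add: \<rho>_def)
    have "\<rho> * norm X < \<rho> * (norm X + 1)" using \<open>0 < \<rho>\<close> by simp
    also have "\<dots> \<le> \<delta> / (norm X + 1) * (norm X + 1)"
      using \<open>norm X + 1 > 0\<close> by (intro mult_right_mono) (simp_all add: \<rho>_def)
    also have "\<dots> = \<delta>" using \<open>norm X + 1 > 0\<close> by simp
    finally show "\<rho> * norm X < \<delta>" .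
  qed
  define r where "r n = \<rho> * inverse (real (Suc n))" for n
  define t where "t n = r n ^ w" for n
  have r0: "r n > 0" for n using \<rho>(1) by (simp add: r_def)
  have r\<rho>: "r n \<le> \<rho>" for n
    using \<rho>(1) mult_left_le[of "inverse (real (Suc n))" \<rho>] by (simp add: r_def inverse_le_1_iff)
  have rlim: "r \<longlonglongrightarrow> 0"
    using tendsto_mult_left[OF LIMSEQ_inverse_real_of_nat, of \<rho>] unfolding r_def by (simp only: mult_zero_right)
  have t0: "t n > 0" for n using r0 by (simp add: t_def)
  have tr: "t n \<le> r n" for n
    using power_decreasing[of 1 w "r n"] w0 r0[of n] r\<rho>[of n] \<rho>(2) by (simp add: t_def)
  have tX: "dil (r n) X = t n *\<^sub>R X" for n using dil_layer[OF X(2)] by (simp add: t_def)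
  have "\<exists>Z Y. Z \<in> S \<and> Y \<in> \<Omega> \<and> (t n *\<^sub>R X) \<star> Z = g Y \<and> hnorm (g Y) \<le> C * (r n * hnorm X)" for n
  proof -
    have "norm (t n *\<^sub>R X) \<le> \<rho> * norm X"
      using t0[of n] tr[of n] r\<rho>[of n] by (simp add: mult_right_mono)
    then have "norm (t n *\<^sub>R X) < \<delta>" using \<rho>(3) by simp
    from lift[OF subspace_scale[OF sT X(1)] this] show ?thesis
      using hnorm_dil[OF r0, of n X] by (auto simp: tX)
  qed
  then obtain Z Y where ZS: "\<And>n. Z n \<in> S" and Y\<Omega>: "\<And>n. Y n \<in> \<Omega>"
    and ZY: "\<And>n. (t n *\<^sub>R X) \<star> Z n = g (Y n)"
    and gle: "\<And>n. hnorm (g (Y n)) \<le> C * (r n * hnorm X)" by metis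
  have "(\<lambda>n. C * (r n * hnorm X)) \<longlonglongrightarrow> C * (0 * hnorm X)" by (intro tendsto_mult tendsto_const rlim)
  then have "(\<lambda>n. hnorm (g (Y n))) \<longlonglongrightarrow> 0"
    by (intro Lim_null_comparison[of "\<lambda>n. hnorm (g (Y n))"]) (use gle in \<open>auto intro!: always_eventually\<close>)
  then have glim: "(\<lambda>n. g (Y n)) \<longlonglongrightarrow> 0" by (rule tendsto_zero_if_hnorm)
  then have Ylim: "Y \<longlonglongrightarrow> 0" using conv Y\<Omega> by blast
  \<comment> \<open>No comparison of \<open>norm (Y n)\<close> with \<open>t n\<close> is available.
    Dividing by their sum keeps both quotients in a compact set whatever their relation.\<close>
  define s where "s n = t n + norm (Y n)" for n
  have s0: "s n > 0" for n using t0[of n] by (simp add: s_def add_pos_nonneg)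
  have bd: "(t n / s n, Y n /\<^sub>R s n) \<in> cball 0 1 \<times> cball 0 1" for n
    using s0[of n] t0[of n] by (simp add: s_def field_simps)
  have "compact (cball (0::real) 1 \<times> cball (0::'a) 1)" by (intro compact_Times compact_cball)
  from seq_compactE[OF compact_imp_seq_compact[OF this], of "\<lambda>n. (t n / s n, Y n /\<^sub>R s n)"] bd
  obtain p \<kappa> where \<kappa>: "strict_mono \<kappa>" and plim: "((\<lambda>n. (t n / s n, Y n /\<^sub>R s n)) \<circ> \<kappa>) \<longlonglongrightarrow> p"
    by blast
  define a where "a = fst p"
  define Y' where "Y' = snd p"
  have alim: "(\<lambda>n. t (\<kappa> n) / s (\<kappa> n)) \<longlonglongrightarrow> a"
    using tendsto_fst[OF plim] by (simp add: o_def a_def)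
  have Y'lim: "(\<lambda>n. Y (\<kappa> n) /\<^sub>R s (\<kappa> n)) \<longlonglongrightarrow> Y'"
    using tendsto_snd[OF plim] by (simp add: o_def Y'_def)
  have Y'T: "Y' \<in> T"
    by (rule closed_sequentially[OF clT _ Y'lim]) (use \<Omega> Y\<Omega> subspace_scale[OF sT] in blast)
  \<comment> \<open>The normalisation survives the limit, so \<open>a\<close> and \<open>Y'\<close>
    cannot both vanish.\<close>
  have sum1: "a + norm Y' = 1"
  proof -
    have "(\<lambda>n. t (\<kappa> n) / s (\<kappa> n) + norm (Y (\<kappa> n) /\<^sub>R s (\<kappa> n))) \<longlonglongrightarrow> a + norm Y'"
      by (intro tendsto_add tendsto_norm alim Y'lim)
    moreover have "t n / s n + norm (Y n /\<^sub>R s n) = 1" for n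
    proof -
      have "t n / s n + norm (Y n /\<^sub>R s n) = (t n + norm (Y n)) / s n"
        using s0[of n] by (simp add: divide_inverse algebra_simps)
      then show ?thesis using s0[of n] by (simp add: s_def)
    qed
    ultimately have "(\<lambda>n. 1) \<longlonglongrightarrow> a + norm Y'" by simp
    then show ?thesis using LIMSEQ_unique tendsto_const by blast
  qed
  have Y\<kappa>: "(\<lambda>n. Y (\<kappa> n)) \<longlonglongrightarrow> 0" using LIMSEQ_subseq_LIMSEQ[OF Ylim \<kappa>] by (simp add: o_def)
  have g\<kappa>: "(\<lambda>n. g (Y (\<kappa> n))) \<longlonglongrightarrow> 0" using LIMSEQ_subseq_LIMSEQ[OF glim \<kappa>] by (simp add: o_def)
  have r\<kappa>: "(\<lambda>n. r (\<kappa> n)) \<longlonglongrightarrow> 0" using LIMSEQ_subseq_LIMSEQ[OF rlim \<kappa>] by (simp add: o_def)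
  have tlim: "t \<longlonglongrightarrow> 0"
    by (rule Lim_null_comparison[OF always_eventually rlim]) (use t0 tr in \<open>auto simp: abs_of_pos\<close>)
  have t\<kappa>: "(\<lambda>n. t (\<kappa> n)) \<longlonglongrightarrow> 0" using LIMSEQ_subseq_LIMSEQ[OF tlim \<kappa>] by (simp add: o_def)
  have gs: "(\<lambda>n. g (Y (\<kappa> n)) /\<^sub>R s (\<kappa> n)) \<longlonglongrightarrow> \<tau> Y'"
    using has_derivative_sequential_quotient[OF der _ Y\<kappa> Y'lim] Y\<Omega> by (simp add: g0)
  \<comment> \<open>\<open>Z n\<close> is the product of \<open>- (t n *\<^sub>R X)\<close> and
    \<open>g (Y n)\<close>, and to first order at the identity products are sums. As
    \<open>S\<close> is a closed linear subspace, the limit stays in it.\<close>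
  have "(\<lambda>n. Z (\<kappa> n) /\<^sub>R s (\<kappa> n)) \<longlonglongrightarrow> - (a *\<^sub>R X) + \<tau> Y'"
  proof -
    define h where "h n = (- (t (\<kappa> n) *\<^sub>R X), g (Y (\<kappa> n)))" for n
    have "h \<longlonglongrightarrow> (- (0 *\<^sub>R X), 0)"
      unfolding h_def by (intro tendsto_Pair tendsto_minus tendsto_scaleR tendsto_const t\<kappa> g\<kappa>)
    then have h0: "h \<longlonglongrightarrow> 0" by (simp add: zero_prod_def)
    have "(\<lambda>n. (- ((t (\<kappa> n) / s (\<kappa> n)) *\<^sub>R X), g (Y (\<kappa> n)) /\<^sub>R s (\<kappa> n))) \<longlonglongrightarrow> (- (a *\<^sub>R X), \<tau> Y')"
      by (intro tendsto_Pair tendsto_minus tendsto_scaleR tendsto_const alim gs)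
    then have hs: "(\<lambda>n. h n /\<^sub>R s (\<kappa> n)) \<longlonglongrightarrow> (- (a *\<^sub>R X), \<tau> Y')"
      by (simp add: h_def divide_inverse mult.commute)
    from has_derivative_sequential_quotient[OF star_has_derivative_zero _ h0 hs]
    have "(\<lambda>n. (fst (h n) \<star> snd (h n)) /\<^sub>R s (\<kappa> n)) \<longlonglongrightarrow> - (a *\<^sub>R X) + \<tau> Y'"
      by (simp add: h_def)
    moreover have "fst (h n) \<star> snd (h n) = Z (\<kappa> n)" for n
      using star_cancel(1)[of "t (\<kappa> n) *\<^sub>R X" "Z (\<kappa> n)"] by (simp add: h_def ZY)
    ultimately show ?thesis by simp
  qed
  then have inS: "- (a *\<^sub>R X) + \<tau> Y' \<in> S"
    by (rule closed_sequentially[OF clS, rotated]) (use ZS subspace_scale[OF sS] in blast)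
  \<comment> \<open>Here transversality enters: for \<open>a = 0\<close> the vector
    \<open>\<tau> Y'\<close> would lie in \<open>S\<close>, forcing \<open>Y' = 0\<close> against
    \<open>sum1\<close>.\<close>
  have a_pos: "a > 0"
  proof -
    have "0 \<le> t n / s n" for n using t0[of n] s0[of n] by simp
    then have "a \<ge> 0" by (intro LIMSEQ_le_const[OF alim] exI[of _ 0]) simp
    moreover have "a \<noteq> 0"
    proof
      assume "a = 0"
      then have "\<tau> Y' \<in> S" using inS by simp
      then have "Y' = 0" using transversal Y'T by blast
      then show False using sum1 \<open>a = 0\<close> by simp
    qed
    ultimately show ?thesis by simp
  qed
  \<comment> \<open>The component is bounded by a multiple of \<open>r n ^ v\<close>, that is
    \<open>r n ^ (v - w) * t n\<close>. Since \<open>t n \<le> s n\<close>, a positive power of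
    \<open>r n\<close> is left after division by \<open>s n\<close>.\<close>
  have van: "comp (\<tau> Y') v = 0" if "v > w" for v
  proof -
    obtain K where K: "K \<ge> 0" "\<And>X. norm (comp X v) \<le> K * hnorm X ^ v"
      using norm_comp_le_hnorm_power by blast
    define E where "E = K * (C * hnorm X) ^ v"
    have bound: "norm (comp (g (Y n) /\<^sub>R s n) v) \<le> \<bar>E\<bar> * r n ^ (v - w)" for n
    proof -
      have "norm (comp (g (Y n)) v) \<le> K * hnorm (g (Y n)) ^ v" by (rule K(2))
      also have "\<dots> \<le> K * (C * (r n * hnorm X)) ^ v"
        by (intro mult_left_mono power_mono gle K(1) hnorm_nonneg)
      also have "\<dots> = E * (r n ^ (v - w) * t n)"
        using \<open>v > w\<close> by (simp add: E_def t_def power_mult_distrib power_add[symmetric])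
      also have "\<dots> \<le> \<bar>E\<bar> * (r n ^ (v - w) * t n)"
        using r0[of n] t0[of n] by (intro mult_right_mono) auto
      also have "\<dots> \<le> \<bar>E\<bar> * (r n ^ (v - w) * s n)"
        using r0[of n] by (intro mult_left_mono) (auto simp: s_def)
      finally have "norm (comp (g (Y n)) v) \<le> (\<bar>E\<bar> * r n ^ (v - w)) * s n" by (simp add: mult.assoc)
      then have "norm (comp (g (Y n)) v) / s n \<le> \<bar>E\<bar> * r n ^ (v - w)"
        using s0[of n] by (simp add: divide_le_eq)
      moreover have "norm (comp (g (Y n) /\<^sub>R s n) v) = norm (comp (g (Y n)) v) / s n"
        using s0[of n] by (simp add: comp_scaleR divide_inverse mult.commute)
      ultimately show ?thesis by simp
    qed
    have "(\<lambda>n. \<bar>E\<bar> * r (\<kappa> n) ^ (v - w)) \<longlonglongrightarrow> \<bar>E\<bar> * 0 ^ (v - w)"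
      by (intro tendsto_mult tendsto_const tendsto_power r\<kappa>)
    then have lim0: "(\<lambda>n. \<bar>E\<bar> * r (\<kappa> n) ^ (v - w)) \<longlonglongrightarrow> 0"
      using \<open>v > w\<close> by (simp add: power_0_left)
    have "(\<lambda>n. comp (g (Y (\<kappa> n)) /\<^sub>R s (\<kappa> n)) v) \<longlonglongrightarrow> 0"
      by (rule Lim_null_comparison[OF always_eventually[OF allI] lim0]) (rule bound)
    moreover have "(\<lambda>n. comp (g (Y (\<kappa> n)) /\<^sub>R s (\<kappa> n)) v) \<longlonglongrightarrow> comp (\<tau> Y') v"
      by (rule bounded_linear.tendsto[OF bounded_linear_comp gs])
    ultimately show ?thesis using LIMSEQ_unique by blast
  qed
  have lin\<tau>: "linear \<tau>" using der has_derivative_linear by blast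
  show ?thesis
  proof (intro bexI conjI allI impI)
    show "inverse a *\<^sub>R Y' \<in> T" by (rule subspace_scale[OF sT Y'T])
    have "inverse a *\<^sub>R (- (a *\<^sub>R X) + \<tau> Y') \<in> S" by (rule subspace_scale[OF sS inS])
    moreover have "inverse a *\<^sub>R (- (a *\<^sub>R X)) = - X" using a_pos by simp
    ultimately have "- X + \<tau> (inverse a *\<^sub>R Y') \<in> S"
      by (simp only: linear_scale[OF lin\<tau>] scaleR_add_right)
    then show "\<tau> (inverse a *\<^sub>R Y') - X \<in> S" by (simp only: uminus_add_conv_diff)
    show "comp (\<tau> (inverse a *\<^sub>R Y')) v = 0" if "w < v" for v
      using van[OF that] by (simp only: linear_scale[OF lin\<tau>] comp_scaleR scaleR_zero_right)
  qed
qed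

end

section \<open>Transversality of the tangent space of the graph\<close>

lemma ex_null_sequence_scaleR_less:
  fixes Y :: "'a::real_normed_vector"
  assumes "e > 0"
  shows "\<exists>s :: nat \<Rightarrow> real. (\<forall>n. 0 < s n) \<and> s \<longlonglongrightarrow> 0 \<and> (\<forall>n. norm (s n *\<^sub>R Y) < e)"
proof -
  define q where "q = e / (norm Y + 1)"
  have pos: "norm Y + 1 > 0" using norm_ge_zero[of Y] by linarith
  have q: "q > 0" using assms pos by (simp add: q_def)
  define s where "s n = q * inverse (real (Suc n))" for n
  have s0: "0 < s n" for n using q by (simp add: s_def)
  have sq: "s n \<le> q" for n
    using q mult_left_le[of "inverse (real (Suc n))" q] by (simp add: s_def inverse_le_1_iff)
  have "s \<longlonglongrightarrow> 0"
    using tendsto_mult_left[OF LIMSEQ_inverse_real_of_nat, of q] unfolding s_def by (simp only: mult_zero_right)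
  moreover have "norm (s n *\<^sub>R Y) < e" for n
  proof -
    have "norm (s n *\<^sub>R Y) \<le> q * norm Y" using s0[of n] sq[of n] by (simp add: mult_right_mono)
    also have "\<dots> < q * (norm Y + 1)" using q by simp
    also have "\<dots> = e" using pos by (simp add: q_def)
    finally show ?thesis .
  qed
  ultimately show ?thesis using s0 by blast
qed

context homogeneous_metric_group
begin

lemma star_right_imp_eq: "X \<star> Y = X \<star> Z \<Longrightarrow> Y = Z"
  using star_cancel(1) by metis

lemma star_decomposition_unique:
  assumes T: "homogeneous_log_subgroup T" and S: "homogeneous_log_subgroup S" and TS: "T \<inter> S = {0}"
    and a: "a \<in> T" "a' \<in> T" and b: "b \<in> S" "b' \<in> S" and eq: "a \<star> b = a' \<star> b'"
  shows "a = a' \<and> b = b'"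
proof -
  have "- a' \<star> (a \<star> b) \<star> (- b) = - a' \<star> (a' \<star> b') \<star> (- b)" by (simp only: eq)
  then have e: "- a' \<star> a = b' \<star> (- b)" by (simp add: star_assoc)
  have "- a' \<star> a \<in> T" using a log_subgroup_simps(3,4)[OF T] by blast
  moreover have "b' \<star> (- b) \<in> S" using b log_subgroup_simps(3,4)[OF S] by blast
  ultimately have "- a' \<star> a \<in> T \<inter> S" using e by simp
  then have "- a' \<star> a = 0" by (simp add: TS)
  then have "a' \<star> (- a' \<star> a) = a' \<star> 0" by (rule arg_cong)
  then have "a = a'" by simp
  then show ?thesis using eq star_right_imp_eq by blast
qed

text \<open>The translate to the identity of the graph of \<open>f\<close>, parametrised by the displacement from \<open>X0\<close>.\<close>

definition translated_graph :: "('a \<Rightarrow> 'a) \<Rightarrow> 'a \<Rightarrow> 'a \<Rightarrow> 'a" where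
  "translated_graph f X0 Y = - (X0 \<star> f X0) \<star> ((X0 + Y) \<star> f (X0 + Y))"

definition displacements :: "'a set \<Rightarrow> 'a \<Rightarrow> 'a set" where
  "displacements \<Omega> X0 = {Y. X0 + Y \<in> \<Omega>}"

context
  fixes T S \<Omega> :: "'a set" and f :: "'a \<Rightarrow> 'a" and X0 :: 'a
  assumes T: "homogeneous_log_subgroup T" and S: "homogeneous_log_subgroup S" and TS: "T \<inter> S = {0}"
    and \<Omega>: "openin (top_of_set T) \<Omega>" and X0: "X0 \<in> \<Omega>" and fS: "\<And>X. X \<in> \<Omega> \<Longrightarrow> f X \<in> S"
    and fder: "\<exists>D. (f has_derivative D) (at X0 within \<Omega>)"
begin

lemma domain_subset: "\<Omega> \<subseteq> T"
  using \<Omega> openin_imp_subset by blast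

lemma displacements_subset: "displacements \<Omega> X0 \<subseteq> T"
proof
  fix Y assume "Y \<in> displacements \<Omega> X0"
  then have "X0 + Y \<in> T" "X0 \<in> T" using domain_subset X0 by (auto simp: displacements_def)
  then have "X0 + Y - X0 \<in> T" using subspace_diff[OF log_subgroup_subspace[OF T]] by blast
  then show "Y \<in> T" by simp
qed

lemma translated_graph_zero: "translated_graph f X0 0 = 0"
  by (simp add: translated_graph_def)

text \<open>Translation by the inverse of \<open>X0 \<star> f X0\<close> leaves a factor
  \<open>- f X0\<close> in front. Conjugating by \<open>f X0\<close> moves it to the right end,
  which restores a factor in \<open>T\<close> followed by a factor in \<open>S\<close>.\<close>

lemma conjugated_translated_graph:
  "(- X0 \<star> (X0 + Y)) \<star> (f (X0 + Y) \<star> (- f X0)) = f X0 \<star> translated_graph f X0 Y \<star> (- f X0)"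
  by (simp add: translated_graph_def minus_star star_assoc)

lemma horizontal_displacement: "Y \<in> displacements \<Omega> X0 \<Longrightarrow> - X0 \<star> (X0 + Y) \<in> T"
  using domain_subset X0 unfolding displacements_def
  by (intro log_subgroup_simps(3)[OF T] log_subgroup_simps(4)[OF T]) auto

lemma vertical_displacement: "Y \<in> displacements \<Omega> X0 \<Longrightarrow> f (X0 + Y) \<star> (- f X0) \<in> S"
  using fS X0 log_subgroup_simps(3,4)[OF S] by (simp add: displacements_def)

lemma has_derivative_translate:
  assumes "(F has_derivative F') (at X0 within \<Omega>)"
  shows "((\<lambda>Y. F (X0 + Y)) has_derivative F') (at 0 within displacements \<Omega> X0)"
proof -
  have 1: "((\<lambda>Y. X0 + Y) has_derivative (\<lambda>h. h)) (at 0 within displacements \<Omega> X0)"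
    by (auto intro!: derivative_eq_intros)
  have "(\<lambda>Y. X0 + Y) ` displacements \<Omega> X0 \<subseteq> \<Omega>" by (auto simp: displacements_def)
  then have "(F has_derivative F') (at (X0 + 0) within (\<lambda>Y. X0 + Y) ` displacements \<Omega> X0)"
    using has_derivative_subset[OF assms] by simp
  from has_derivative_in_compose[OF 1 this] show ?thesis by simp
qed

text \<open>After conjugation, separation of \<open>T\<close> and \<open>S\<close> bounds the
  \<open>T\<close> factor by the whole product. That factor determines the displacement by left
  translation with \<open>X0\<close>.\<close>

lemma displacements_tend_to_zero:
  assumes Y: "\<And>n::nat. Y n \<in> displacements \<Omega> X0" and lim: "(\<lambda>n. translated_graph f X0 (Y n)) \<longlonglongrightarrow> 0"
  shows "Y \<longlonglongrightarrow> 0"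
proof -
  define a where "a n = - X0 \<star> (X0 + Y n)" for n
  define b where "b n = f (X0 + Y n) \<star> (- f X0)" for n
  obtain c where c: "c > 0" "\<And>x y. \<lbrakk>x \<in> T; y \<in> S\<rbrakk> \<Longrightarrow> c * hnorm x \<le> hnorm (- x \<star> y)"
    using log_subgroups_separated[OF T S TS] by auto
  have "(\<lambda>n. f X0 \<star> translated_graph f X0 (Y n) \<star> (- f X0)) \<longlonglongrightarrow> f X0 \<star> 0 \<star> (- f X0)"
    by (intro tendsto_star tendsto_const lim)
  then have "(\<lambda>n. a n \<star> b n) \<longlonglongrightarrow> 0"
    by (simp add: a_def b_def conjugated_translated_graph)
  from tendsto_mult_left[OF tendsto_hnorm[OF this], of "inverse c"]
  have lim0: "(\<lambda>n. inverse c * hnorm (a n \<star> b n)) \<longlonglongrightarrow> 0" by simp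
  have le: "norm (hnorm (a n)) \<le> inverse c * hnorm (a n \<star> b n)" for n
  proof -
    have "- a n \<in> T" "b n \<in> S"
      using horizontal_displacement[OF Y] vertical_displacement[OF Y] log_subgroup_simps(4)[OF T]
      by (simp_all add: a_def b_def)
    from c(2)[OF this] have "c * hnorm (a n) \<le> hnorm (a n \<star> b n)" by simp
    then show ?thesis using c(1) by (simp add: field_simps)
  qed
  have "(\<lambda>n. hnorm (a n)) \<longlonglongrightarrow> 0"
    by (rule Lim_null_comparison[OF always_eventually[OF allI] lim0]) (rule le)
  then have "a \<longlonglongrightarrow> 0" by (rule tendsto_zero_if_hnorm)
  then have "(\<lambda>n. X0 \<star> a n - X0) \<longlonglongrightarrow> X0 \<star> 0 - X0" by (intro tendsto_diff tendsto_star tendsto_const)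
  then show ?thesis by (simp add: a_def)
qed

text \<open>Differentiating the conjugated identity gives \<open>E Y + B Y = Ad (\<tau> Y)\<close>,
  with \<open>E Y\<close> in \<open>T\<close> and \<open>B Y\<close> in \<open>S\<close>. If
  \<open>\<tau> Y\<close> is in \<open>S\<close>, so is its image under \<open>Ad\<close>; then
  \<open>E Y\<close> lies in both subspaces and vanishes, and \<open>E\<close> is injective on such
  \<open>Y\<close>.\<close>

lemma translated_graph_transversal:
  assumes der: "(translated_graph f X0 has_derivative \<tau>) (at 0 within displacements \<Omega> X0)"
    and Y: "Y \<in> T" "\<tau> Y \<in> S"
  shows "Y = 0"
proof -
  note sT = log_subgroup_subspace[OF T] and sS = log_subgroup_subspace[OF S]
  obtain e where e: "e > 0" "ball X0 e \<inter> T \<subseteq> \<Omega>" using \<Omega> X0 by (meson openin_contains_ball)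
  obtain s :: "nat \<Rightarrow> real" where s: "\<And>n. 0 < s n" "s \<longlonglongrightarrow> 0" "\<And>n. norm (s n *\<^sub>R Y) < e"
    using ex_null_sequence_scaleR_less[OF e(1)] by metis
  define h where "h n = s n *\<^sub>R Y" for n
  have hd: "h n \<in> displacements \<Omega> X0" for n
  proof -
    have "X0 + h n \<in> T"
      unfolding h_def using domain_subset X0 Y(1) by (intro subspace_add[OF sT] subspace_scale[OF sT]) auto
    moreover have "X0 + h n \<in> ball X0 e" using s(3) by (simp add: h_def dist_norm)
    ultimately show ?thesis using e(2) by (auto simp: displacements_def)
  qed
  have h0: "h \<longlonglongrightarrow> 0" using tendsto_scaleR[OF s(2) tendsto_const[of Y]] unfolding h_def by simp
  have sn: "s n \<noteq> 0" for n using s(1)[of n] by simp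
  have hs: "(\<lambda>n. h n /\<^sub>R s n) \<longlonglongrightarrow> Y" using sn by (simp add: h_def)
  define g where "g n = translated_graph f X0 (h n)" for n
  have gs: "(\<lambda>n. g n /\<^sub>R s n) \<longlonglongrightarrow> \<tau> Y"
    using has_derivative_sequential_quotient[OF der _ h0 hs] hd by (simp add: g_def translated_graph_zero)
  have "(\<lambda>n. s n *\<^sub>R (g n /\<^sub>R s n)) \<longlonglongrightarrow> 0 *\<^sub>R \<tau> Y" by (intro tendsto_scaleR s(2) gs)
  then have g0: "g \<longlonglongrightarrow> 0" using sn by simp
  define \<kappa> where "\<kappa> Z = f X0 \<star> Z \<star> (- f X0)" for Z
  obtain Ad1 where Ad1: "((\<lambda>Z. f X0 \<star> Z) has_derivative Ad1) (at 0)"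
    using star_has_derivative_compose[OF has_derivative_const has_derivative_ident] by blast
  obtain Ad where Ad: "(\<kappa> has_derivative Ad) (at 0)"
    unfolding \<kappa>_def using star_has_derivative_compose[OF Ad1 has_derivative_const] by blast
  have \<kappa>0: "\<kappa> 0 = 0" by (simp add: \<kappa>_def)
  \<comment> \<open>Since \<open>f X0\<close> is in \<open>S\<close>, conjugation by it preserves
    \<open>S\<close>; difference quotients and their limits stay in the closed linear
    subspace.\<close>
  have AdS: "Ad Z \<in> S" if "Z \<in> S" for Z
  proof -
    obtain r :: "nat \<Rightarrow> real" where r: "\<And>n. 0 < r n" "r \<longlonglongrightarrow> 0"
      using ex_null_sequence_scaleR_less[of 1 Z] by auto
    have rn: "r n \<noteq> 0" for n using r(1)[of n] by simp
    have 1: "(\<lambda>n. r n *\<^sub>R Z) \<longlonglongrightarrow> 0" using tendsto_scaleR[OF r(2) tendsto_const[of Z]] by simp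
    have 2: "(\<lambda>n. (r n *\<^sub>R Z) /\<^sub>R r n) \<longlonglongrightarrow> Z" using rn by simp
    have lim: "(\<lambda>n. \<kappa> (r n *\<^sub>R Z) /\<^sub>R r n) \<longlonglongrightarrow> Ad Z"
      using has_derivative_sequential_quotient[OF Ad _ 1 2] by (simp add: \<kappa>0)
    have "\<kappa> (r n *\<^sub>R Z) /\<^sub>R r n \<in> S" for n
      unfolding \<kappa>_def using fS[OF X0] that
      by (intro subspace_scale[OF sS] log_subgroup_simps(3,4)[OF S])
    then show ?thesis using closed_sequentially[OF log_subgroup_simps(1)[OF S] _ lim] by blast
  qed
  have \<kappa>lim: "(\<lambda>n. \<kappa> (g n) /\<^sub>R s n) \<longlonglongrightarrow> Ad (\<tau> Y)"
    using has_derivative_sequential_quotient[OF Ad _ g0 gs] by (simp add: \<kappa>0)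
  obtain E where E: "((\<lambda>Y. - X0 \<star> (X0 + Y)) has_derivative E) (at 0)"
    using star_has_derivative_compose[OF has_derivative_const has_derivative_add[OF has_derivative_const has_derivative_ident]]
    by blast
  obtain D where "(f has_derivative D) (at X0 within \<Omega>)" using fder by blast
  from has_derivative_translate[OF this]
  obtain B where B: "((\<lambda>Y. f (X0 + Y) \<star> (- f X0)) has_derivative B) (at 0 within displacements \<Omega> X0)"
    using star_has_derivative_compose[OF _ has_derivative_const] by blast
  have E': "((\<lambda>Y. - X0 \<star> (X0 + Y)) has_derivative E) (at 0 within displacements \<Omega> X0)"
    using E by (rule has_derivative_at_withinI)
  define a where "a n = - X0 \<star> (X0 + h n)" for n
  define b where "b n = f (X0 + h n) \<star> (- f X0)" for n
  have as: "(\<lambda>n. a n /\<^sub>R s n) \<longlonglongrightarrow> E Y"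
    using has_derivative_sequential_quotient[OF E _ h0 hs] by (simp add: a_def)
  have bs: "(\<lambda>n. b n /\<^sub>R s n) \<longlonglongrightarrow> B Y"
    using has_derivative_sequential_quotient[OF B _ h0 hs] hd by (simp add: b_def)
  have "(\<lambda>n. (a n \<star> b n) /\<^sub>R s n) \<longlonglongrightarrow> E Y + B Y"
    using has_derivative_sequential_quotient[OF star_has_derivative_at_zero[OF E' B] _ h0 hs] hd
    by (simp add: a_def b_def)
  moreover have "a n \<star> b n = \<kappa> (g n)" for n
    by (simp only: a_def b_def \<kappa>_def g_def conjugated_translated_graph)
  ultimately have "(\<lambda>n. \<kappa> (g n) /\<^sub>R s n) \<longlonglongrightarrow> E Y + B Y" by (simp only:)
  then have eq: "E Y + B Y = Ad (\<tau> Y)" using \<kappa>lim by (rule LIMSEQ_unique)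
  have "b n /\<^sub>R s n \<in> S" for n
    unfolding b_def by (intro subspace_scale[OF sS] vertical_displacement hd)
  then have "B Y \<in> S" using closed_sequentially[OF log_subgroup_simps(1)[OF S] _ bs] by blast
  then have "Ad (\<tau> Y) - B Y \<in> S" by (intro subspace_diff[OF sS] AdS Y(2))
  then have ES: "E Y \<in> S" by (simp only: eq[symmetric] add_diff_cancel_right')
  have "a n /\<^sub>R s n \<in> T" for n
    unfolding a_def by (intro subspace_scale[OF sT] horizontal_displacement hd)
  then have "E Y \<in> T" using closed_sequentially[OF log_subgroup_simps(1)[OF T] _ as] by blast
  then have "E Y \<in> T \<inter> S" using ES by blast
  then have EY: "E Y = 0" by (simp add: TS)
  \<comment> \<open>Left translation by \<open>X0\<close> undoes the map with derivative
    \<open>E\<close>, up to adding \<open>X0\<close>. So \<open>F\<close> recovers \<open>Y\<close>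
    from \<open>E Y\<close>, which is the injectivity needed.\<close>
  obtain F where F: "((\<lambda>Z. X0 \<star> Z) has_derivative F) (at 0)"
    using star_has_derivative_compose[OF has_derivative_const has_derivative_ident] by blast
  have "(\<lambda>n. s n *\<^sub>R (a n /\<^sub>R s n)) \<longlonglongrightarrow> 0 *\<^sub>R E Y" by (intro tendsto_scaleR s(2) as)
  then have a0: "a \<longlonglongrightarrow> 0" using sn by simp
  have "(\<lambda>n. (X0 \<star> a n - X0) /\<^sub>R s n) \<longlonglongrightarrow> F (E Y)"
    using has_derivative_sequential_quotient[OF F _ a0 as] by simp
  then have "(\<lambda>n. h n /\<^sub>R s n) \<longlonglongrightarrow> F (E Y)" by (simp add: a_def)
  from LIMSEQ_unique[OF hs this] have "Y = F (E Y)" .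
  then show "Y = 0" using EY linear_0[OF has_derivative_linear[OF F]] by simp
qed

end

end

section \<open>Bases adapted to the tangent space and to the grading\<close>

text \<open>The linear map sending each basis vector \<open>x\<close> to \<open>y x\<close> is an
  injective endomorphism of \<open>T\<close>, hence onto by dimension. If it kills \<open>u\<close>,
  applying \<tau> and subtracting \<open>u\<close> shows \<open>- u\<close> to be a combination of
  the vectors \<open>\<tau> (y x) - x\<close>, so \<open>u\<close> lies in
  \<open>T \<inter> S\<close>.\<close>

lemma span_of_transversal_perturbation:
  fixes T S B :: "'a::euclidean_space set" and \<tau> y :: "'a \<Rightarrow> 'a"
  assumes T: "subspace T" and S: "subspace S" and TS: "T \<inter> S = {0}" and lin: "linear \<tau>"
    and B: "independent B" "span B = T"
    and y: "\<And>x. x \<in> B \<Longrightarrow> y x \<in> T" "\<And>x. x \<in> B \<Longrightarrow> \<tau> (y x) - x \<in> S"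
    and z: "z \<in> T"
  shows "\<exists>c. z = (\<Sum>x\<in>B. c x *\<^sub>R y x)"
proof -
  have finB: "finite B" using B(1) independent_imp_finite by blast
  obtain g where g: "linear g" "\<And>x. x \<in> B \<Longrightarrow> g x = y x"
    using linear_independent_extend[OF B(1), of y] by blast
  have gsum: "g (\<Sum>x\<in>B. c x *\<^sub>R x) = (\<Sum>x\<in>B. c x *\<^sub>R y x)" for c
    unfolding linear_sum[OF g(1)] linear_scale[OF g(1)] using g(2) by (intro sum.cong) auto
  have Bsum: "\<exists>c. u = (\<Sum>x\<in>B. c x *\<^sub>R x)" if "u \<in> T" for u
    using that unfolding B(2)[symmetric] span_finite[OF finB] by blast
  have gT: "g u \<in> T" if u: "u \<in> T" for u
  proof -
    obtain c where "u = (\<Sum>x\<in>B. c x *\<^sub>R x)" using Bsum[OF u] by blast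
    then have "g u = (\<Sum>x\<in>B. c x *\<^sub>R y x)" using gsum by simp
    also have "\<dots> \<in> T" by (intro subspace_sum[OF T] subspace_scale[OF T] y(1))
    finally show ?thesis .
  qed
  have ker: "u = 0" if u: "u \<in> T" "g u = 0" for u
  proof -
    obtain c where c: "u = (\<Sum>x\<in>B. c x *\<^sub>R x)" using Bsum[OF u(1)] by blast
    then have "\<tau> (\<Sum>x\<in>B. c x *\<^sub>R y x) = 0" using gsum[of c] u(2) linear_0[OF lin] by simp
    then have "(\<Sum>x\<in>B. c x *\<^sub>R \<tau> (y x)) = 0" by (simp only: linear_sum[OF lin] linear_scale[OF lin])
    then have "(\<Sum>x\<in>B. c x *\<^sub>R (\<tau> (y x) - x)) = - u"
      by (simp add: c scaleR_diff_right sum_subtractf)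
    moreover have "(\<Sum>x\<in>B. c x *\<^sub>R (\<tau> (y x) - x)) \<in> S"
      by (intro subspace_sum[OF S] subspace_scale[OF S] y(2))
    ultimately have "- u \<in> S" by simp
    then have "u \<in> S" using subspace_neg[OF S, of "- u"] by simp
    then have "u \<in> T \<inter> S" using u(1) by blast
    then show "u = 0" by (simp add: TS)
  qed
  have "inj_on g (span T)"
  proof (rule inj_onI)
    fix u v assume uv: "u \<in> span T" "v \<in> span T" "g u = g v"
    then have "u - v \<in> T" using T by (simp add: span_eq_iff[THEN iffD2] subspace_diff)
    moreover have "g (u - v) = 0" using uv(3) linear_diff[OF g(1)] by simp
    ultimately have "u - v = 0" by (rule ker)
    then show "u = v" by simp
  qed
  from dim_image_eq[OF g(1) this] have "dim (g ` T) = dim T" .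
  moreover have "g ` T \<subseteq> T" using gT by blast
  ultimately have "g ` T = T"
    using subspace_dim_equal[OF linear_subspace_image[OF g(1) T] T] by simp
  then obtain u where u: "u \<in> T" "z = g u" using z by blast
  obtain c where "u = (\<Sum>x\<in>B. c x *\<^sub>R x)" using Bsum[OF u(1)] by blast
  then have "z = (\<Sum>x\<in>B. c x *\<^sub>R y x)" using u(2) gsum by simp
  then show ?thesis by blast
qed

context positively_graded_group
begin

text \<open>Bases of the intersections with the layers are united. They span because
  \<open>T\<close> contains the components of its elements, and they are disjoint because distinct
  layers share only 0. Summing weights over the union yields the degree formula.\<close>

lemma ex_graded_basis:
  assumes T: "subspace T" and compT: "\<And>X w. X \<in> T \<Longrightarrow> comp X w \<in> T"
  shows "\<exists>B wt. independent B \<and> span B = T \<and>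
    (\<forall>x\<in>B. x \<in> T \<and> wt x \<in> weights G \<and> x \<in> layer G (wt x)) \<and>
    (\<Sum>x\<in>B. wt x) = (\<Sum>w\<in>weights G. w * dim (T \<inter> layer G w))"
proof -
  have "\<exists>C. C \<subseteq> T \<inter> layer G w \<and> independent C \<and> T \<inter> layer G w \<subseteq> span C \<and> card C = dim (T \<inter> layer G w)" for w
    using basis_exists by metis
  then obtain C where C: "\<And>w. C w \<subseteq> T \<inter> layer G w" "\<And>w. independent (C w)"
    "\<And>w. T \<inter> layer G w \<subseteq> span (C w)" "\<And>w. card (C w) = dim (T \<inter> layer G w)" by metis
  have finC: "finite (C w)" for w using C(2) independent_imp_finite by blast
  have layC: "x \<in> layer G w" if "x \<in> C w" for x w using C(1) that by blast
  have nz: "x \<noteq> 0" if "x \<in> C w" for x w using C(2)[of w] that dependent_zero by blast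
  have disj: "w = v" if "x \<in> C w" "x \<in> C v" for x v w
  proof (rule ccontr)
    assume "w \<noteq> v"
    then have "comp x w = 0" using comp_layer[OF layC[OF that(2)]] by simp
    moreover have "comp x w = x" using comp_layer[OF layC[OF that(1)]] by simp
    ultimately show False using nz[OF that(1)] by simp
  qed
  define B where "B = (\<Union>w\<in>weights G. C w)"
  define wt where "wt x = (THE w. x \<in> C w)" for x
  have wt: "wt x = w" if "x \<in> C w" for x w
    unfolding wt_def using that disj by (intro the_equality) auto
  have finB: "finite B" unfolding B_def using finite_weights finC by blast
  have "independent B"
  proof (rule independent_if_scalars_zero[OF finB])
    fix c x assume sum0: "(\<Sum>x\<in>B. c x *\<^sub>R x) = 0" and "x \<in> B"
    then obtain w where w: "w \<in> weights G" "x \<in> C w" by (auto simp: B_def)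
    have "(\<Sum>x\<in>B. c x *\<^sub>R comp x w) = comp (\<Sum>x\<in>B. c x *\<^sub>R x) w"
      by (simp only: linear_sum[OF linear_comp] comp_scaleR)
    also have "\<dots> = 0" using sum0 linear_0[OF linear_comp] by simp
    finally have "(\<Sum>x\<in>B. c x *\<^sub>R comp x w) = 0" .
    moreover have "(\<Sum>x\<in>B. c x *\<^sub>R comp x w) = (\<Sum>x\<in>C w. c x *\<^sub>R x)"
    proof (rule sum.mono_neutral_cong_right[OF finB])
      show "C w \<subseteq> B" using w(1) by (auto simp: B_def)
      show "\<forall>x\<in>B - C w. c x *\<^sub>R comp x w = 0"
      proof
        fix x assume "x \<in> B - C w"
        then obtain v where "x \<in> C v" "v \<noteq> w" by (auto simp: B_def)
        then show "c x *\<^sub>R comp x w = 0" using comp_layer[OF layC] by simp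
      qed
      show "c x *\<^sub>R comp x w = c x *\<^sub>R x" if "x \<in> C w" for x
        using comp_layer[OF layC[OF that]] by simp
    qed
    ultimately have "(\<Sum>x\<in>C w. c x *\<^sub>R x) = 0" by simp
    then show "c x = 0" using independentD[OF C(2) finC order_refl _ w(2)] by blast
  qed
  moreover have "span B = T"
  proof (rule span_unique[OF _ T])
    show "B \<subseteq> T" using C(1) by (auto simp: B_def)
    fix U assume U: "B \<subseteq> U" "subspace U"
    show "T \<subseteq> U"
    proof
      fix X assume "X \<in> T"
      have "comp X w \<in> U" if "w \<in> weights G" for w
      proof -
        have "comp X w \<in> span (C w)" using C(3)[of w] compT[OF \<open>X \<in> T\<close>, of w] comp_in_layer[of X w] by blast
        moreover have "span (C w) \<subseteq> U" using U that by (intro span_minimal) (auto simp: B_def)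
        ultimately show ?thesis by blast
      qed
      then have "(\<Sum>w\<in>weights G. comp X w) \<in> U" by (rule subspace_sum[OF U(2)])
      then show "X \<in> U" by (simp only: sum_comp)
    qed
  qed
  moreover have "\<forall>x\<in>B. x \<in> T \<and> wt x \<in> weights G \<and> x \<in> layer G (wt x)"
    using C(1) wt by (auto simp: B_def)
  moreover have "(\<Sum>x\<in>B. wt x) = (\<Sum>w\<in>weights G. w * dim (T \<inter> layer G w))"
  proof -
    have "(\<Sum>x\<in>B. wt x) = (\<Sum>w\<in>weights G. \<Sum>x\<in>C w. wt x)"
      unfolding B_def using finite_weights finC disj by (intro sum.UNION_disjoint) auto
    also have "\<dots> = (\<Sum>w\<in>weights G. w * dim (T \<inter> layer G w))"
      using C(4) wt by (intro sum.cong) (simp_all add: mult.commute)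
    finally show ?thesis .
  qed
  ultimately show ?thesis by blast
qed

section \<open>Intrinsic graphs in exponential coordinates\<close>

lemma exp_mem_iff: "H \<subseteq> carrier G \<Longrightarrow> expmap G X \<in> H \<longleftrightarrow> X \<in> logmap G ` H"
proof
  assume H: "H \<subseteq> carrier G"
  show "X \<in> logmap G ` H" if "expmap G X \<in> H"
    using imageI[OF that, of "logmap G"] by simp
  assume "X \<in> logmap G ` H"
  then obtain x where "x \<in> H" "X = logmap G x" by blast
  then show "expmap G X \<in> H" using H by auto
qed

lemma mem_translated_intrinsic_graph_iff:
  assumes A: "A \<subseteq> carrier G" and \<phi>: "\<And>w. w \<in> A \<Longrightarrow> \<phi> w \<in> carrier G" and v: "v \<in> carrier G"
  shows "expmap G X \<otimes> v \<in> inv (expmap G \<xi>) <# intrinsic_graph G A \<phi> \<longleftrightarrow>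
    (\<exists>X'\<in>logmap G ` A. X \<star> logmap G v = - \<xi> \<star> (X' \<star> logmap G (\<phi> (expmap G X'))))"
proof
  assume "expmap G X \<otimes> v \<in> inv (expmap G \<xi>) <# intrinsic_graph G A \<phi>"
  then obtain w where w: "w \<in> A" "expmap G X \<otimes> v = inv (expmap G \<xi>) \<otimes> (w \<otimes> \<phi> w)"
    by (auto simp: l_coset_def intrinsic_graph_def)
  have wc: "w \<in> carrier G" using w(1) A by blast
  have "logmap G (expmap G X \<otimes> v) = logmap G (inv (expmap G \<xi>) \<otimes> (w \<otimes> \<phi> w))" using w(2) by simp
  then have "X \<star> logmap G v = - \<xi> \<star> (logmap G w \<star> logmap G (\<phi> w))"
    using v wc \<phi>[OF w(1)] by (simp add: log_mult log_inv)
  then show "\<exists>X'\<in>logmap G ` A. X \<star> logmap G v = - \<xi> \<star> (X' \<star> logmap G (\<phi> (expmap G X')))"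
    using w(1) wc by (intro bexI[of _ "logmap G w"]) simp_all
next
  assume "\<exists>X'\<in>logmap G ` A. X \<star> logmap G v = - \<xi> \<star> (X' \<star> logmap G (\<phi> (expmap G X')))"
  then obtain w where w: "w \<in> A" "X \<star> logmap G v = - \<xi> \<star> (logmap G w \<star> logmap G (\<phi> (expmap G (logmap G w))))"
    by blast
  have wc: "w \<in> carrier G" using w(1) A by blast
  have "expmap G (X \<star> logmap G v) = expmap G (- \<xi> \<star> (logmap G w \<star> logmap G (\<phi> w)))" using w(2) wc by simp
  then have "expmap G X \<otimes> v = inv (expmap G \<xi>) \<otimes> (w \<otimes> \<phi> w)"
    using v wc \<phi>[OF w(1)] by (simp add: exp_star exp_minus)
  then show "expmap G X \<otimes> v \<in> inv (expmap G \<xi>) <# intrinsic_graph G A \<phi>"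
    using w(1) by (auto simp: l_coset_def intrinsic_graph_def)
qed

lemma complementary_log_subgroups:
  assumes WV: "complementary_subgroups G W V"
  shows "W \<subseteq> carrier G" and "V \<subseteq> carrier G"
    and "homogeneous_log_subgroup (logmap G ` W)" and "homogeneous_log_subgroup (logmap G ` V)"
    and "logmap G ` W \<inter> logmap G ` V = {0}"
proof -
  have W: "homogeneous_subgroup G W" and V: "homogeneous_subgroup G V" and WV1: "W \<inter> V = {\<one>}"
    using WV by (simp_all add: complementary_subgroups_def)
  show Wc: "W \<subseteq> carrier G" and Vc: "V \<subseteq> carrier G"
    using W V by (simp_all add: homogeneous_subgroup_def subgroup.subset)
  show T: "homogeneous_log_subgroup (logmap G ` W)" and S: "homogeneous_log_subgroup (logmap G ` V)"
    by (rule homogeneous_log_subgroup_log_image[OF W] homogeneous_log_subgroup_log_image[OF V])+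
  have "X = 0" if X: "X \<in> logmap G ` W" "X \<in> logmap G ` V" for X
  proof -
    have "expmap G X \<in> W \<inter> V"
      using X exp_mem_iff[OF Wc] exp_mem_iff[OF Vc] by simp
    then have "expmap G X = expmap G 0" by (simp add: WV1 exp_zero)
    then show "X = 0" by (simp only: exp_inj)
  qed
  then show "logmap G ` W \<inter> logmap G ` V = {0}"
    using log_subgroup_simps(2)[OF T] log_subgroup_simps(2)[OF S] by blast
qed

end

text \<open>Relative openness keeps a whole interval of parameters around 0 inside \<open>S\<close>,
  so the derivative within \<open>S\<close> restricts to a two-sided derivative along the
  line.\<close>

lemma has_vector_derivative_along_subspace:
  assumes F: "(F has_derivative F') (at x within S)" and S: "openin (top_of_set T) S"
    and T: "subspace T" and x: "x \<in> S" and v: "v \<in> T"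
  shows "((\<lambda>t. F (x + t *\<^sub>R v)) has_vector_derivative F' v) (at 0)"
proof -
  obtain e where e: "e > 0" "ball x e \<inter> T \<subseteq> S" using S x by (meson openin_contains_ball)
  have xT: "x \<in> T" using S x openin_imp_subset by blast
  define U where "U = (\<lambda>t. x + t *\<^sub>R v) -` ball x e"
  have "open U" unfolding U_def by (intro open_vimage open_ball continuous_intros)
  have "0 \<in> U" using e(1) by (simp add: U_def)
  have "(\<lambda>t. x + t *\<^sub>R v) ` U \<subseteq> S"
    using e(2) subspace_add[OF T xT subspace_scale[OF T v]] by (auto simp: U_def)
  then have 1: "(F has_derivative F') (at (x + 0 *\<^sub>R v) within (\<lambda>t. x + t *\<^sub>R v) ` U)"
    using has_derivative_subset[OF F] by simp
  have 2: "((\<lambda>t. x + t *\<^sub>R v) has_derivative (\<lambda>t. t *\<^sub>R v)) (at 0 within U)"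
    by (auto intro!: derivative_eq_intros)
  from has_derivative_in_compose[OF 2 1]
  have "((\<lambda>t. F (x + t *\<^sub>R v)) has_derivative (\<lambda>t. F' (t *\<^sub>R v))) (at 0)"
    using at_within_open[OF \<open>0 \<in> U\<close> \<open>open U\<close>] by simp
  then show ?thesis
    using linear_scale[OF has_derivative_linear[OF F]] by (simp add: has_vector_derivative_def)
qed

context homogeneous_metric_group
begin

text \<open>The point of the translated graph over \<open>X\<close> is the point of the graph of
  \<open>L\<close> over \<open>X\<close> times an error. Differentiability controls the error. The
  graph of \<open>L\<close> is a homogeneous subgroup meeting \<open>V\<close> only in the identity,
  so separation controls the other factor linearly.\<close>

lemma intrinsic_differential_imp_hnorm_bound:
  assumes WV: "complementary_subgroups G W V" and AW: "A \<subseteq> W" and \<phi>: "\<phi> \<in> A \<rightarrow> V"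
    and X0: "X0 \<in> logmap G ` A"
    and diff: "has_intrinsic_differential G d W V A \<phi> (expmap G X0) L"
  defines "f \<equiv> \<lambda>X. logmap G (\<phi> (expmap G X))"
  shows "\<exists>C \<delta>. \<delta> > 0 \<and> (\<forall>X\<in>logmap G ` W. norm X < \<delta> \<longrightarrow>
    (\<exists>Z\<in>logmap G ` V. \<exists>Y\<in>displacements (logmap G ` A) X0.
      X \<star> Z = translated_graph f X0 Y \<and> hnorm (translated_graph f X0 Y) \<le> C * hnorm X))"
proof -
  define T S where "T = logmap G ` W" and "S = logmap G ` V"
  note Wc = complementary_log_subgroups(1)[OF WV] and Vc = complementary_log_subgroups(2)[OF WV]
  have T: "homogeneous_log_subgroup T" and S: "homogeneous_log_subgroup S" and TS: "T \<inter> S = {0}"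
    unfolding T_def S_def by (rule complementary_log_subgroups(3-5)[OF WV])+
  have Ac: "A \<subseteq> carrier G" using AW Wc by blast
  have \<phi>V: "\<phi> w \<in> V" if "w \<in> A" for w using \<phi> that by blast
  have \<phi>c: "\<phi> w \<in> carrier G" if "w \<in> A" for w using \<phi>V[OF that] Vc by blast
  have expA: "expmap G X \<in> A" if "X \<in> logmap G ` A" for X using that exp_mem_iff[OF Ac] by simp
  have fS: "f X \<in> S" if "X \<in> logmap G ` A" for X
    unfolding f_def S_def using \<phi>V[OF expA[OF that]] by (rule imageI)
  have AT: "logmap G ` A \<subseteq> T" unfolding T_def using AW by (rule image_mono)
  define \<xi> where "\<xi> = X0 \<star> f X0"
  define \<Gamma> where "\<Gamma> = inv (expmap G X0 \<otimes> \<phi> (expmap G X0)) <# intrinsic_graph G A \<phi>"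
  have \<xi>: "expmap G X0 \<otimes> \<phi> (expmap G X0) = expmap G \<xi>"
    using \<phi>c[OF expA[OF X0]] by (simp add: \<xi>_def f_def exp_star)
  have mem: "expmap G X \<otimes> v \<in> \<Gamma> \<longleftrightarrow> (\<exists>X'\<in>logmap G ` A. X \<star> logmap G v = - \<xi> \<star> (X' \<star> f X'))"
    if "v \<in> carrier G" for X v
    unfolding \<Gamma>_def \<xi> f_def by (rule mem_translated_intrinsic_graph_iff[OF Ac \<phi>c that])
  \<comment> \<open>\<open>graph_map\<close> is a definite description, so uniqueness must come
    first. Two points over the same \<open>X\<close> differ by a right factor in \<open>V\<close>;
    undoing the translation gives two points of the original graph with the same \<open>W\<close>
    factor.\<close>
  have uniq: "v1 = v2" if v: "v1 \<in> V" "v2 \<in> V" "expmap G X \<otimes> v1 \<in> \<Gamma>" "expmap G X \<otimes> v2 \<in> \<Gamma>" for X v1 v2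
  proof -
    have vc: "v1 \<in> carrier G" "v2 \<in> carrier G" using v(1,2) Vc by auto
    obtain X1 where X1: "X1 \<in> logmap G ` A" "X \<star> logmap G v1 = - \<xi> \<star> (X1 \<star> f X1)"
      using v(3) mem[OF vc(1)] by blast
    obtain X2 where X2: "X2 \<in> logmap G ` A" "X \<star> logmap G v2 = - \<xi> \<star> (X2 \<star> f X2)"
      using v(4) mem[OF vc(2)] by blast
    have "\<xi> \<star> (X \<star> logmap G v1) = X1 \<star> f X1" by (simp only: X1(2) star_cancel)
    then have "\<xi> \<star> X \<star> logmap G v1 \<star> (- logmap G v1 \<star> logmap G v2) = X1 \<star> f X1 \<star> (- logmap G v1 \<star> logmap G v2)"
      by (simp only: star_assoc)
    moreover have "\<xi> \<star> X \<star> logmap G v1 \<star> (- logmap G v1 \<star> logmap G v2) = \<xi> \<star> (X \<star> logmap G v2)"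
      by (simp add: star_assoc)
    moreover have "\<xi> \<star> (X \<star> logmap G v2) = X2 \<star> f X2" by (simp only: X2(2) star_cancel)
    ultimately have eq: "X1 \<star> (f X1 \<star> (- logmap G v1 \<star> logmap G v2)) = X2 \<star> f X2"
      by (simp only: star_assoc)
    have "logmap G v1 \<in> S" "logmap G v2 \<in> S" unfolding S_def by (rule imageI[OF v(1)] imageI[OF v(2)])+
    then have "f X1 \<star> (- logmap G v1 \<star> logmap G v2) \<in> S"
      using fS[OF X1(1)] by (intro log_subgroup_simps(3,4)[OF S])
    from star_decomposition_unique[OF T S TS _ _ this fS[OF X2(1)] eq]
    have "X1 = X2" using AT X1(1) X2(1) by blast
    then have "X \<star> logmap G v1 = X \<star> logmap G v2" using X1(2) X2(2) by (simp only:)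
    then have "logmap G v1 = logmap G v2" by (rule star_right_imp_eq)
    then have "expmap G (logmap G v1) = expmap G (logmap G v2)" by (rule arg_cong)
    then show "v1 = v2" using vc by simp
  qed
  define \<psi> where "\<psi> X = logmap G (graph_map G V \<Gamma> (expmap G X))" for X
  have \<psi>: "\<psi> X \<in> S \<and> graph_map G V \<Gamma> (expmap G X) = expmap G (\<psi> X) \<and>
      (\<exists>Y\<in>displacements (logmap G ` A) X0. X \<star> \<psi> X = translated_graph f X0 Y)"
    if dom: "expmap G X \<in> graph_domain G W V \<Gamma>" for X
  proof -
    obtain v where v: "v \<in> V" "expmap G X \<otimes> v \<in> \<Gamma>" using dom unfolding graph_domain_def by blast
    have vc: "v \<in> carrier G" using v(1) Vc by blast
    have gm: "graph_map G V \<Gamma> (expmap G X) = v"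
      unfolding graph_map_def using v uniq by (intro the_equality) auto
    obtain X' where X': "X' \<in> logmap G ` A" "X \<star> logmap G v = - \<xi> \<star> (X' \<star> f X')"
      using v(2) mem[OF vc] by blast
    have "X' - X0 \<in> displacements (logmap G ` A) X0"
      using X'(1) by (simp add: displacements_def)
    moreover have "X \<star> logmap G v = translated_graph f X0 (X' - X0)"
      using X'(2) by (simp add: translated_graph_def \<xi>_def)
    moreover have "logmap G v \<in> S" unfolding S_def using v(1) by (rule imageI)
    ultimately show ?thesis using vc by (auto simp: \<psi>_def gm)
  qed
  have lin: "L \<in> W \<rightarrow> V" "homogeneous_subgroup G (intrinsic_graph G W L)"
    using diff by (simp_all add: has_intrinsic_differential_def intrinsic_linear_def)
  define l where "l X = logmap G (L (expmap G X))" for X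
  define H where "H = logmap G ` intrinsic_graph G W L"
  have H: "homogeneous_log_subgroup H"
    unfolding H_def by (rule homogeneous_log_subgroup_log_image[OF lin(2)])
  have LV: "L (expmap G X) \<in> V" if "X \<in> T" for X
  proof -
    have "expmap G X \<in> W" using that exp_mem_iff[OF Wc] by (simp add: T_def)
    then show ?thesis using lin(1) by blast
  qed
  have lS: "l X \<in> S" if "X \<in> T" for X
    unfolding l_def S_def using LV[OF that] by (rule imageI)
  have expl: "expmap G (l X) = L (expmap G X)" if "X \<in> T" for X
  proof -
    have "L (expmap G X) \<in> carrier G" using LV[OF that] Vc by (rule subsetD[rotated])
    then show ?thesis by (simp add: l_def)
  qed
  have H_D: "\<exists>u\<in>T. h = u \<star> l u" if h: "h \<in> H" for h
  proof -
    obtain w where w: "w \<in> W" "h = logmap G (w \<otimes> L w)"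
      using h by (auto simp: H_def intrinsic_graph_def)
    have "w \<in> carrier G" "L w \<in> carrier G" using w(1) Wc Vc lin(1) by auto
    then have "h = logmap G w \<star> l (logmap G w)" using w(2) by (simp add: log_mult l_def)
    then show ?thesis using w(1) by (auto simp: T_def)
  qed
  have H_I: "u \<star> l u \<in> H" if "u \<in> T" for u
  proof -
    have "expmap G u \<in> W" using that exp_mem_iff[OF Wc] by (simp add: T_def)
    then have "expmap G u \<otimes> L (expmap G u) \<in> intrinsic_graph G W L"
      by (auto simp: intrinsic_graph_def)
    then have "expmap G (u \<star> l u) \<in> intrinsic_graph G W L" by (simp add: exp_star expl[OF that])
    then have "logmap G (expmap G (u \<star> l u)) \<in> H" unfolding H_def by (rule imageI)
    then show ?thesis by simp
  qed
  have base: "u = 0" if u: "u \<in> T" "u \<star> l u \<in> S" for u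
  proof -
    have "u \<star> l u \<star> (- l u) \<in> S" by (intro log_subgroup_simps(3,4)[OF S] u(2) lS[OF u(1)])
    then have "u \<in> S" by (simp add: star_assoc)
    then have "u \<in> T \<inter> S" using u(1) by blast
    then show ?thesis by (simp add: TS)
  qed
  \<comment> \<open>The identity belongs to the subgroup \<open>H\<close>, hence equals
    \<open>u \<star> l u\<close> for some \<open>u\<close>, and \<open>base\<close> forces
    \<open>u = 0\<close>.\<close>
  have l0: "l 0 = 0"
  proof -
    obtain u where u: "u \<in> T" "0 = u \<star> l u" using H_D[OF log_subgroup_simps(2)[OF H]] by blast
    then have "u = 0" using base[OF u(1)] log_subgroup_simps(2)[OF S] by simp
    then show ?thesis using u(2) by simp
  qed
  have HS: "H \<inter> S = {0}"
  proof -
    have "h = 0" if h: "h \<in> H" "h \<in> S" for h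
    proof -
      obtain u where u: "u \<in> T" "h = u \<star> l u" using H_D[OF h(1)] by blast
      then have "u = 0" using base[OF u(1)] h(2) by simp
      then show "h = 0" using u(2) l0 by simp
    qed
    then show ?thesis using log_subgroup_simps(2)[OF H] log_subgroup_simps(2)[OF S] by blast
  qed
  obtain c where c: "c > 0" "\<And>x y. \<lbrakk>x \<in> H; y \<in> S\<rbrakk> \<Longrightarrow> c * hnorm x \<le> hnorm (- x \<star> y)"
    using log_subgroups_separated[OF H S HS] by auto
  \<comment> \<open>Separation is applied to the inverses of \<open>u \<star> l u\<close> and
    \<open>l u\<close>: the product measured there, \<open>u \<star> l u \<star> (- l u)\<close>, is
    \<open>u\<close> itself.\<close>
  have lin_bound: "hnorm (u \<star> l u) \<le> inverse c * hnorm u" if "u \<in> T" for u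
  proof -
    have "- (u \<star> l u) \<in> H" "- l u \<in> S"
      using H_I[OF that] lS[OF that] log_subgroup_simps(4)[OF H] log_subgroup_simps(4)[OF S] by simp_all
    from c(2)[OF this] have "c * hnorm (u \<star> l u) \<le> hnorm (u \<star> l u \<star> (- l u))"
      by (simp only: hnorm_minus minus_minus)
    then show ?thesis using c(1) by (simp add: star_assoc field_simps)
  qed
  have ev: "\<forall>\<^sub>F X in at 0 within T. expmap G X \<in> graph_domain G W V \<Gamma>"
    and o: "(\<lambda>X. d \<one> (inv (L (expmap G X)) \<otimes> graph_map G V \<Gamma> (expmap G X)))
           \<in> o[at 0 within T](\<lambda>X. d \<one> (expmap G X))"
    using diff by (simp_all add: has_intrinsic_differential_def Let_def \<Gamma>_def T_def)
  \<comment> \<open>The little-o estimate is taken with constant 1, which becomes the summand 1 in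
    the final constant \<open>inverse c + 1\<close>.\<close>
  have "\<forall>\<^sub>F X in at 0 within T.
      norm (d \<one> (inv (L (expmap G X)) \<otimes> graph_map G V \<Gamma> (expmap G X))) \<le> 1 * norm (d \<one> (expmap G X))"
    using o by (rule landau_o.smallD) simp
  with ev have "\<forall>\<^sub>F X in at 0 within T. expmap G X \<in> graph_domain G W V \<Gamma> \<and>
      norm (d \<one> (inv (L (expmap G X)) \<otimes> graph_map G V \<Gamma> (expmap G X))) \<le> 1 * norm (d \<one> (expmap G X))"
    by (rule eventually_conj)
  then obtain \<delta> where \<delta>: "\<delta> > 0" "\<forall>X\<in>T. X \<noteq> 0 \<and> dist X 0 < \<delta> \<longrightarrow> expmap G X \<in> graph_domain G W V \<Gamma> \<and>
      norm (d \<one> (inv (L (expmap G X)) \<otimes> graph_map G V \<Gamma> (expmap G X))) \<le> 1 * norm (d \<one> (expmap G X))"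
    unfolding eventually_at by blast
  have "\<exists>Z\<in>S. \<exists>Y\<in>displacements (logmap G ` A) X0.
      X \<star> Z = translated_graph f X0 Y \<and> hnorm (translated_graph f X0 Y) \<le> (inverse c + 1) * hnorm X"
    if X: "X \<in> T" "norm X < \<delta>" for X
  \<comment> \<open>The punctured filter says nothing at \<open>X = 0\<close>; there the base point
    itself, with zero displacement, is the witness.\<close>
  proof (cases "X = 0")
    case True
    have "0 \<in> displacements (logmap G ` A) X0" using X0 by (simp add: displacements_def)
    moreover have "translated_graph f X0 0 = 0" by (simp add: translated_graph_def)
    ultimately show ?thesis using True log_subgroup_simps(2)[OF S] by (intro bexI[of _ 0]) simp_all
  next
    case False
    then have X': "expmap G X \<in> graph_domain G W V \<Gamma>"
      "norm (d \<one> (inv (L (expmap G X)) \<otimes> graph_map G V \<Gamma> (expmap G X))) \<le> 1 * norm (d \<one> (expmap G X))"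
      using \<delta>(2) X by simp_all
    obtain Y where Y: "\<psi> X \<in> S" "graph_map G V \<Gamma> (expmap G X) = expmap G (\<psi> X)"
      "Y \<in> displacements (logmap G ` A) X0" "X \<star> \<psi> X = translated_graph f X0 Y"
      using \<psi>[OF X'(1)] by blast
    have "inv (L (expmap G X)) \<otimes> graph_map G V \<Gamma> (expmap G X) = expmap G (- l X \<star> \<psi> X)"
      by (simp only: Y(2) expl[OF X(1), symmetric] exp_star exp_minus)
    then have le: "hnorm (- l X \<star> \<psi> X) \<le> hnorm X" using X'(2) by (simp add: hnorm_def)
    have "X \<star> \<psi> X = X \<star> l X \<star> (- l X \<star> \<psi> X)" by (simp add: star_assoc)
    then have "hnorm (X \<star> \<psi> X) \<le> hnorm (X \<star> l X) + hnorm (- l X \<star> \<psi> X)"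
      using hnorm_star by metis
    also have "\<dots> \<le> inverse c * hnorm X + hnorm X" by (intro add_mono lin_bound X(1) le)
    also have "\<dots> = (inverse c + 1) * hnorm X" by (simp add: distrib_right)
    finally have "hnorm (translated_graph f X0 Y) \<le> (inverse c + 1) * hnorm X" by (simp only: Y(4))
    then show ?thesis using Y(1,3,4) by blast
  qed
  then show ?thesis using \<delta>(1) unfolding T_def S_def by blast
qed

section \<open>Vanishing of the form on the graph\<close>

lemma covector_weight_eq_0:
  assumes \<theta>: "covector_weight G \<theta> v" and Z: "\<And>u. u > w \<Longrightarrow> comp Z u = 0" and "w < v"
  shows "\<theta> Z = 0"
proof -
  have lin: "linear \<theta>" using \<theta> by (simp add: covector_weight_def)
  have "\<theta> (comp Z u) = 0" for u
  proof (cases "u = v")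
    case True
    then show ?thesis using Z[of u] \<open>w < v\<close> linear_0[OF lin] by simp
  next
    case False
    then show ?thesis using \<theta> comp_in_layer[of Z u] unfolding covector_weight_def by blast
  qed
  then have "(\<Sum>u\<in>weights G. \<theta> (comp Z u)) = 0" by simp
  then have "\<theta> (\<Sum>u\<in>weights G. comp Z u) = 0" by (simp only: linear_sum[OF lin])
  then show ?thesis by (simp only: sum_comp)
qed

lemma wedge_vanishes_on_graph:
  assumes WV: "complementary_subgroups G W V" and A: "open_in_subgroup G W A" and \<phi>: "\<phi> \<in> A \<rightarrow> V"
    and C2: "C2_map G W A \<phi>" and k: "k = dim (lie_algebra G W)"
    and b: "ordered_basis k b (lie_algebra G W)"
    and diff: "\<And>w. w \<in> A \<Longrightarrow> \<exists>L. has_intrinsic_differential G d W V A \<phi> w L"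
    and X0: "X0 \<in> logmap G ` A"
    and \<theta>: "\<And>i. i < k \<Longrightarrow> covector_weight G (\<theta> i) (wt i)"
    and deg: "subgroup_degree G W < (\<Sum>i<k. wt i)"
  shows "wedge k \<theta> (\<lambda>i. maurer_cartan G (graph_param G \<phi> X0)
    (vector_derivative (\<lambda>t. logmap G (graph_param G \<phi> (X0 + t *\<^sub>R b i))) (at 0))) = 0"
proof -
  define T S \<Omega> where "T = logmap G ` W" and "S = logmap G ` V" and "\<Omega> = logmap G ` A"
  note Wc = complementary_log_subgroups(1)[OF WV] and Vc = complementary_log_subgroups(2)[OF WV]
  have T: "homogeneous_log_subgroup T" and S: "homogeneous_log_subgroup S" and TS: "T \<inter> S = {0}"
    unfolding T_def S_def by (rule complementary_log_subgroups(3-5)[OF WV])+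
  have AW: "A \<subseteq> W" and op: "openin (top_of_set T) \<Omega>"
    using A by (simp_all add: open_in_subgroup_def T_def \<Omega>_def)
  note sT = log_subgroup_subspace[OF T] and sS = log_subgroup_subspace[OF S]
  have lieW: "lie_algebra G W = T" by (rule lie_algebra_eq_log_image[OF T T_def Wc])
  have Ac: "A \<subseteq> carrier G" using AW Wc by blast
  have \<Omega>A: "expmap G X \<in> A" if "X \<in> \<Omega>" for X using that exp_mem_iff[OF Ac] by (simp add: \<Omega>_def)
  have \<phi>V: "\<phi> (expmap G X) \<in> V" if "X \<in> \<Omega>" for X using \<phi> \<Omega>A[OF that] by blast
  have X0': "X0 \<in> \<Omega>" using X0 by (simp add: \<Omega>_def)
  define f where "f X = logmap G (\<phi> (expmap G X))" for X
  have fS: "f X \<in> S" if "X \<in> \<Omega>" for X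
    unfolding f_def S_def using \<phi>V[OF that] by (rule imageI)
  define \<gamma> where "\<gamma> X = logmap G (graph_param G \<phi> X)" for X
  have \<gamma>: "\<gamma> X = X \<star> f X" "graph_param G \<phi> X = expmap G (\<gamma> X)" if "X \<in> \<Omega>" for X
  proof -
    have "\<phi> (expmap G X) \<in> carrier G" using \<phi>V[OF that] Vc by blast
    then show "\<gamma> X = X \<star> f X" "graph_param G \<phi> X = expmap G (\<gamma> X)"
      by (simp_all add: \<gamma>_def f_def graph_param_def log_mult exp_star)
  qed
  have "Ck_along (Suc 1) T \<Omega> f"
    using C2 unfolding C2_map_def lieW \<Omega>_def f_def by (simp only: numeral_2_eq_2 One_nat_def)
  from Ck_along_Suc_imp_has_derivative[OF this sT op X0']
  obtain D where D: "(f has_derivative D) (at X0 within \<Omega>)" by blast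
  then have fder: "\<exists>D. (f has_derivative D) (at X0 within \<Omega>)" by blast
  obtain \<Gamma> where \<Gamma>': "((\<lambda>X. X \<star> f X) has_derivative \<Gamma>) (at X0 within \<Omega>)"
    using star_has_derivative_compose[OF has_derivative_ident D] by blast
  have \<Gamma>: "(\<gamma> has_derivative \<Gamma>) (at X0 within \<Omega>)"
    by (rule has_derivative_transform[OF X0' _ \<Gamma>']) (rule \<gamma>(1))
  obtain E where E: "((\<lambda>Z. - \<gamma> X0 \<star> Z) has_derivative E) (at (\<gamma> X0))"
    using star_has_derivative_compose[OF has_derivative_const has_derivative_ident] by blast
  have "((\<lambda>X. - \<gamma> X0 \<star> \<gamma> X) has_derivative (\<lambda>h. E (\<Gamma> h))) (at X0 within \<Omega>)"
    by (rule has_derivative_compose[OF \<Gamma> E])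
  from has_derivative_translate[OF T S TS op X0' fS fder this]
  have "((\<lambda>Y. - \<gamma> X0 \<star> \<gamma> (X0 + Y)) has_derivative (\<lambda>h. E (\<Gamma> h))) (at 0 within displacements \<Omega> X0)" .
  note \<tau>' = this
  have "0 \<in> displacements \<Omega> X0" using X0' by (simp add: displacements_def)
  moreover have "translated_graph f X0 Y = - \<gamma> X0 \<star> \<gamma> (X0 + Y)" if "Y \<in> displacements \<Omega> X0" for Y
    using that \<gamma>(1) X0' by (simp add: translated_graph_def displacements_def)
  ultimately have der: "(translated_graph f X0 has_derivative (\<lambda>h. E (\<Gamma> h))) (at 0 within displacements \<Omega> X0)"
    by (rule has_derivative_transform[OF _ _ \<tau>'])
  define \<tau> where "\<tau> h = E (\<Gamma> h)" for h
  have \<tau>: "(translated_graph f X0 has_derivative \<tau>) (at 0 within displacements \<Omega> X0)"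
    unfolding \<tau>_def by (rule der)
  have lin\<tau>: "linear \<tau>" using \<tau> has_derivative_linear by blast
  \<comment> \<open>\<open>\<Gamma>\<close> differentiates the graph map and \<open>E\<close> the
    left translation to the identity. Both sides are thus the tangent vector read in the Lie
    algebra, and the form sees only \<open>\<tau> v\<close>.\<close>
  have tangent: "maurer_cartan G (graph_param G \<phi> X0)
      (vector_derivative (\<lambda>t. logmap G (graph_param G \<phi> (X0 + t *\<^sub>R v))) (at 0)) = \<tau> v" if v: "v \<in> T" for v
  proof -
    have "((\<lambda>t. \<gamma> (X0 + t *\<^sub>R v)) has_vector_derivative \<Gamma> v) (at 0)"
      by (rule has_vector_derivative_along_subspace[OF \<Gamma> op sT X0' v])
    then have 1: "vector_derivative (\<lambda>t. logmap G (graph_param G \<phi> (X0 + t *\<^sub>R v))) (at 0) = \<Gamma> v"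
      unfolding \<gamma>_def by (rule vector_derivative_at)
    have "((\<lambda>t. - \<gamma> X0 \<star> (\<gamma> X0 + t *\<^sub>R \<Gamma> v)) has_vector_derivative E (\<Gamma> v)) (at 0)"
      by (rule has_vector_derivative_along_subspace[OF E, of UNIV]) (simp_all add: subspace_UNIV)
    then have "vector_derivative (\<lambda>t. - \<gamma> X0 \<star> (\<gamma> X0 + t *\<^sub>R \<Gamma> v)) (at 0) = E (\<Gamma> v)"
      by (rule vector_derivative_at)
    then show ?thesis
      unfolding 1 \<tau>_def maurer_cartan_def \<gamma>(2)[OF X0'] exp_minus[symmetric] exp_star[symmetric] log_exp .
  qed
  obtain C \<delta> where \<delta>: "\<delta> > 0" and lift: "\<And>X. \<lbrakk>X \<in> T; norm X < \<delta>\<rbrakk> \<Longrightarrow>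
      \<exists>Z\<in>S. \<exists>Y\<in>displacements \<Omega> X0. X \<star> Z = translated_graph f X0 Y \<and>
        hnorm (translated_graph f X0 Y) \<le> C * hnorm X"
  proof -
    obtain L where "has_intrinsic_differential G d W V A \<phi> (expmap G X0) L"
      using diff[OF \<Omega>A[OF X0']] by blast
    from intrinsic_differential_imp_hnorm_bound[OF WV AW \<phi> X0 this] show ?thesis
      using that unfolding T_def S_def \<Omega>_def f_def by blast
  qed
  have lifted: "\<exists>Y\<in>T. \<tau> Y - X \<in> S \<and> (\<forall>v>w. comp (\<tau> Y) v = 0)"
    if "X \<in> T" "X \<in> layer G w" "w \<in> weights G" for X w
  proof (rule graph_tangent_blow_up[OF T S _ _ \<tau> _ _ \<delta> lift that])
    show "displacements \<Omega> X0 \<subseteq> T" by (rule displacements_subset[OF T S TS op X0' fS fder])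
    show "translated_graph f X0 0 = 0" by (simp add: translated_graph_def)
    show "Y = 0" if "Y \<in> T" "\<tau> Y \<in> S" for Y
      by (rule translated_graph_transversal[OF T S TS op X0' fS fder \<tau> that])
    show "Y \<longlonglongrightarrow> 0" if "\<And>n. Y n \<in> displacements \<Omega> X0" "(\<lambda>n. translated_graph f X0 (Y n)) \<longlonglongrightarrow> 0"
      for Y :: "nat \<Rightarrow> 'a"
      by (rule displacements_tend_to_zero[OF T S TS op X0' fS fder that])
  qed
  obtain B \<mu> where B: "independent B" "span B = T"
    and B\<mu>: "\<And>x. x \<in> B \<Longrightarrow> x \<in> T \<and> \<mu> x \<in> weights G \<and> x \<in> layer G (\<mu> x)"
    and sum\<mu>: "(\<Sum>x\<in>B. \<mu> x) = (\<Sum>w\<in>weights G. w * dim (T \<inter> layer G w))"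
    using ex_graded_basis[OF sT log_subgroup_comp[OF T]] by metis
  have "\<exists>Y. Y \<in> T \<and> \<tau> Y - x \<in> S \<and> (\<forall>v>\<mu> x. comp (\<tau> Y) v = 0)" if "x \<in> B" for x
    using lifted[of x "\<mu> x"] B\<mu>[OF that] by blast
  then obtain y where y: "\<And>x. x \<in> B \<Longrightarrow> y x \<in> T" "\<And>x. x \<in> B \<Longrightarrow> \<tau> (y x) - x \<in> S"
    "\<And>x v. \<lbrakk>x \<in> B; v > \<mu> x\<rbrakk> \<Longrightarrow> comp (\<tau> (y x)) v = 0" by metis
  have finB: "finite B" using B(1) independent_imp_finite by blast
  have "card B = k" using dim_eq_card[OF _ B(1), of T] B(2) sT by (simp add: k lieW span_eq_iff[THEN iffD2])
  \<comment> \<open>The enumeration gives the adapted basis the index range \<open>{..<k}\<close> of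
    the wedge product; the lengths agree since \<open>k\<close> is the dimension of
    \<open>T\<close>.\<close>
  then obtain u where u: "bij_betw u {..<k} B"
    using ex_bij_betw_nat_finite[OF finB] by (auto simp: atLeast0LessThan)
  have uB: "u l \<in> B" if "l < k" for l using bij_betwE[OF u] that by blast
  have bT: "b j \<in> T" if "j < k" for j
    using b that unfolding ordered_basis_def lieW by (metis imageI lessThan_iff span_base)
  \<comment> \<open>The integration basis \<open>b\<close> is unrelated to the grading. Expanding it
    in the vectors \<open>y x\<close> reduces the claim, up to a determinant, to the tangent vectors
    \<open>\<tau> (y x)\<close> with controlled weights.\<close>
  have "\<exists>c. b j = (\<Sum>x\<in>B. c x *\<^sub>R y x)" if "j < k" for j
    by (rule span_of_transversal_perturbation[OF sT sS TS lin\<tau> B y(1,2) bT[OF that]])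
  then obtain c where c: "\<And>j. j < k \<Longrightarrow> b j = (\<Sum>x\<in>B. c j x *\<^sub>R y x)" by metis
  define v where "v i = maurer_cartan G (graph_param G \<phi> X0)
    (vector_derivative (\<lambda>t. logmap G (graph_param G \<phi> (X0 + t *\<^sub>R b i))) (at 0))" for i
  have v: "v j = (\<Sum>l<k. c j (u l) *\<^sub>R \<tau> (y (u l)))" if "j < k" for j
  proof -
    have "v j = \<tau> (b j)" unfolding v_def by (rule tangent[OF bT[OF that]])
    also have "\<dots> = (\<Sum>x\<in>B. c j x *\<^sub>R \<tau> (y x))"
      unfolding c[OF that] linear_sum[OF lin\<tau>] linear_scale[OF lin\<tau>] ..
    also have "\<dots> = (\<Sum>l<k. c j (u l) *\<^sub>R \<tau> (y (u l)))" by (rule sum.reindex_bij_betw[OF u, symmetric])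
    finally show ?thesis .
  qed
  have "wedge k \<theta> (\<lambda>l. \<tau> (y (u l))) = 0"
  proof (rule wedge_eq_0_if_weights_exceed)
    show "\<theta> i (\<tau> (y (u l))) = 0" if "i < k" "l < k" "\<mu> (u l) < wt i" for i l
      by (rule covector_weight_eq_0[OF \<theta>[OF that(1)] y(3)[OF uB[OF that(2)]] that(3)])
    have "(\<Sum>l<k. \<mu> (u l)) = (\<Sum>x\<in>B. \<mu> x)" by (rule sum.reindex_bij_betw[OF u])
    also have "\<dots> = subgroup_degree G W" by (simp add: sum\<mu> subgroup_degree_def lieW)
    finally show "(\<Sum>l<k. \<mu> (u l)) < (\<Sum>i<k. wt i)" using deg by simp
  qed
  moreover have "wedge k \<theta> v = wedge k \<theta> (\<lambda>l. \<tau> (y (u l))) *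
      Determinant.det (Matrix.mat k k (\<lambda>(l, j). c j (u l)))"
    using \<theta> v by (intro wedge_change_basis) (simp_all add: covector_weight_def)
  ultimately show ?thesis unfolding v_def by simp
qed

end

theorem corollary5p14:
  fixes G :: "('g, 'a::euclidean_space) graded_lie_group"
    and d :: "'g \<Rightarrow> 'g \<Rightarrow> real"
    and W V A :: "'g set"
    and \<phi> :: "'g \<Rightarrow> 'g" and D\<phi> :: "'g \<Rightarrow> 'g \<Rightarrow> 'g"
    and k p :: nat
    and b :: "nat \<Rightarrow> 'a" and \<epsilon> :: "'a \<Rightarrow> real"
    and \<alpha> :: "'g \<Rightarrow> (nat \<Rightarrow> 'a) \<Rightarrow> real"
  assumes "positively_graded_group G"
    and "homogeneous_distance G d"
    and "complementary_subgroups G W V"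
    and "open_in_subgroup G W A"
    and "\<phi> \<in> A \<rightarrow> V"
    and "C2_map G W A \<phi>"
    and "k = dim (lie_algebra G W)"
    and "ordered_basis k b (lie_algebra G W)"
    and "orientation_sign G A \<epsilon>"
    and "\<And>w. w \<in> A \<Longrightarrow> has_intrinsic_differential G d W V A \<phi> w (D\<phi> w)"
    and "continuous_intrinsic_differential G d W A D\<phi>"
    and "\<alpha> \<in> weighted_forms G k p"
    and "p > subgroup_degree G W"
  shows "has_graph_integral G k b A \<phi> \<epsilon> \<alpha> 0"
proof -
  interpret homogeneous_metric_group G d
    using assms(1,2) by (simp add: homogeneous_metric_group_def homogeneous_metric_group_axioms_def)
  obtain n :: nat and f \<theta> wt where
    wt: "\<And>j i. \<lbrakk>j < n; i < k\<rbrakk> \<Longrightarrow> covector_weight G (\<theta> j i) (wt j i)"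
      "\<And>j. j < n \<Longrightarrow> (\<Sum>i<k. wt j i) = p"
    and \<alpha>: "\<And>x v. x \<in> carrier G \<Longrightarrow>
      \<alpha> x v = (\<Sum>j<n. f j x * wedge k (\<theta> j) (\<lambda>i. maurer_cartan G x (v i)))"
    using assms(12) unfolding weighted_forms_def by blast
  have vanish: "\<alpha> (graph_param G \<phi> X)
      (\<lambda>i. vector_derivative (\<lambda>t. logmap G (graph_param G \<phi> (X + t *\<^sub>R b i))) (at 0)) = 0"
    if X: "X \<in> logmap G ` A" for X
  proof -
    have WV: "subgroup W G" "subgroup V G"
      using assms(3) by (simp_all add: complementary_subgroups_def homogeneous_subgroup_def)
    have "A \<subseteq> carrier G"
      using assms(4) subgroup.subset[OF WV(1)] by (auto simp: open_in_subgroup_def)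
    then have "expmap G X \<in> A" using X exp_mem_iff by blast
    then have "graph_param G \<phi> X \<in> carrier G"
      using assms(5) subgroup.subset[OF WV(2)] by (auto simp: graph_param_def)
    moreover have "wedge k (\<theta> j) (\<lambda>i. maurer_cartan G (graph_param G \<phi> X)
        (vector_derivative (\<lambda>t. logmap G (graph_param G \<phi> (X + t *\<^sub>R b i))) (at 0))) = 0"
      if j: "j < n" for j
    proof (rule wedge_vanishes_on_graph[OF assms(3-8) _ X wt(1)[OF j]])
      show "\<exists>L. has_intrinsic_differential G d W V A \<phi> w L" if "w \<in> A" for w
        using assms(10)[OF that] by blast
      show "subgroup_degree G W < (\<Sum>i<k. wt j i)" using assms(13) wt(2)[OF j] by simp
    qed
    ultimately show ?thesis by (simp add: \<alpha>)
  qed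
  \<comment> \<open>The integrand is identically zero: on the domain by \<open>vanish\<close>,
    elsewhere by the indicator. This settles integrability together with the value, for every
    orientation sign.\<close>
  have "(\<lambda>u. let X = \<Sum>i<k. u i *\<^sub>R b i in
      indicator (logmap G ` A) X * (\<epsilon> X * \<alpha> (graph_param G \<phi> X)
        (\<lambda>i. vector_derivative (\<lambda>t. logmap G (graph_param G \<phi> (X + t *\<^sub>R b i))) (at 0)))) = (\<lambda>u. 0 :: real)"
    by (intro ext) (simp add: Let_def indicator_def vanish)
  then show ?thesis unfolding has_graph_integral_def by (simp only: has_bochner_integral_zero)
qed

end
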